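(* Let $n$ be odd. Let $\mathcal{E}$ be an ensemble of local symplectic circuits on $n$ qubits, with respect to $J=i^n\bigotimes_{j=1}^nY_j$, of depth $d$, such that $\Phi_{\mathcal{E}}(|0^n\rangle\langle0^n|^{\otimes2})$ is a relative-error $\epsilon$-approximate state $2$-design for $\epsilon<1$. Then the lightcone starting from any qubit must contain all other qubits. In particular, this implies a depth lower bound of $\Omega(n)$ in one-dimensional architectures and of $\Omega(\log n)$ in the all-to-all architecture.
   Context: $Y_j$ is the Pauli-$Y$ matrix on qubit $j$. A unitary $U\in\mathrm{U}(2^n)$ is symplectic if $UJU^T=J$; these form the group $\mathrm{USp}(2^n)$. A local gate acting as $V$ on $r$ qubits and as the identity elsewhere is symplectic if $V\,Y^{\otimes r}V^T=Y^{\otimes r}$. A local symplectic circuit is built from layers of such gates with disjoint supports, each gate acting on a constant number of qubits allowed by the architecture graph (vertices are qubits; one-dimensional: a line, with open or closed boundary; all-to-all: the complete graph). The depth of an ensemble is the maximal depth of its circuits. The lightcone starting from a qubit is the set of qubits obtained from that qubit by going through the layers of the circuit one after the other and adding, in each layer, the supports of all gates that act on a qubit already reached. $\Phi_{\mathcal{E}}(A)=\mathbb{E}_{U\sim\mathcal{E}}U^{\otimes 2}A\,U^{\dagger,\otimes 2}$, so $\Phi_{\mathcal{E}}(|0^n\rangle\langle0^n|^{\otimes2})$ is the second moment of the state ensemble $\{U|0^n\rangle\}_{U\sim\mathcal{E}}$. It is a relative-error $\epsilon$-approximate state $2$-design if $(1-\epsilon)\,\mathbb{E}_{\psi}|\psi\rangle\langle\psi|^{\otimes2}\preceq\Phi_{\mathcal{E}}(|0^n\rangle\langle0^n|^{\otimes2})\preceq(1+\epsilon)\,\mathbb{E}_{\psi}|\psi\rangle\langle\psi|^{\otimes2}$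 in the positive-semidefinite order, where $|\psi\rangle=U|0^n\rangle$ with $U$ Haar-random in $\mathrm{USp}(2^n)$ (equivalently in $\mathrm{U}(2^n)$, since both groups induce the same distribution on pure states).
   Formalization: Every circuit's lightcone is full only if all circuits share one gate layout (else false: mix in the empty circuit with small weight); for random layouts, with positive probability each qubit's backward lightcone is full and each given qubit lies in another's forward lightcone. *)

theory Defs
  imports
    "HOL-Probability.Probability"
    "Jordan_Normal_Form.Schur_Decomposition"
begin

hide_const (open) Finite_Cartesian_Product.mat Finite_Cartesian_Product.vec
no_notation Finite_Cartesian_Product.vec_nth (infixl \<open>$\<close> 90)

text \<open>
  Operators on \<open>n\<close> qubits are matrices of dimension \<open>2 ^ n\<close>.  The bit \<open>bit x j\<close> of an index \<open>x\<close>
  is the value of qubit \<open>j < n\<close> in the computational basis state \<open>x\<close>.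
\<close>

subsection \<open>Matrices\<close>

definition kron :: "complex mat \<Rightarrow> complex mat \<Rightarrow> complex mat" where
  "kron A B = mat (dim_row A * dim_row B) (dim_col A * dim_col B)
     (\<lambda>(i, j). A $$ (i div dim_row B, j div dim_col B) * B $$ (i mod dim_row B, j mod dim_col B))"

fun kron_power :: "complex mat \<Rightarrow> nat \<Rightarrow> complex mat" where
  "kron_power A 0 = 1\<^sub>m 1"
| "kron_power A (Suc r) = kron A (kron_power A r)"

definition unitary_group :: "nat \<Rightarrow> complex mat set" where
  "unitary_group N = {U \<in> carrier_mat N N. U * mat_adjoint U = 1\<^sub>m N \<and> mat_adjoint U * U = 1\<^sub>m N}"

text \<open>Positive-semidefinite order; for complex numbers, \<open>0 \<le> z\<close> means that \<open>z\<close> is real and nonnegative.\<close>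

definition loewner_le :: "complex mat \<Rightarrow> complex mat \<Rightarrow> bool" where
  "loewner_le A B \<longleftrightarrow> (\<exists>N. A \<in> carrier_mat N N \<and> B \<in> carrier_mat N N \<and>
     (\<forall>v \<in> carrier_vec N. 0 \<le> ((B - A) *\<^sub>v v) \<bullet>c v))"

definition ket_bra :: "complex vec \<Rightarrow> complex mat" where
  "ket_bra v = mat (dim_vec v) (dim_vec v) (\<lambda>(i, j). v $ i * conjugate (v $ j))"

definition zero_state :: "nat \<Rightarrow> complex vec" where
  "zero_state n = unit_vec (2 ^ n) 0"

definition pauli_Y :: "complex mat" where
  "pauli_Y = mat_of_rows_list 2 [[0, - \<i>], [\<i>, 0]]"

subsection \<open>The unitary symplectic group and its Haar measure\<close>

definition J_form :: "nat \<Rightarrow> complex mat" where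
  "J_form n = \<i> ^ n \<cdot>\<^sub>m kron_power pauli_Y n"

definition USp :: "nat \<Rightarrow> complex mat set" where
  "USp n = {U \<in> unitary_group (2 ^ n). U * J_form n * transpose_mat U = J_form n}"

text \<open>
  The Borel \<open>\<sigma>\<close>-algebra of a set \<open>S\<close> of \<open>N \<times> N\<close> matrices, generated by the matrix entries.
\<close>

definition mat_borel_sets :: "nat \<Rightarrow> complex mat set \<Rightarrow> complex mat set set" where
  "mat_borel_sets N S =
     sigma_sets S {{U \<in> S. U $$ (i, j) \<in> B} | i j B. i < N \<and> j < N \<and> B \<in> sets borel}"

definition haar_USp :: "nat \<Rightarrow> complex mat measure \<Rightarrow> bool" where
  "haar_USp n H \<longleftrightarrow> prob_space H \<and> space H = USp n \<and> sets H = mat_borel_sets (2 ^ n) (USp n) \<and>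
     (\<forall>g \<in> USp n. distr H H (\<lambda>U. g * U) = H)"

subsection \<open>Second moments and approximate state designs\<close>

definition mat_expectation :: "'a measure \<Rightarrow> nat \<Rightarrow> ('a \<Rightarrow> complex mat) \<Rightarrow> complex mat" where
  "mat_expectation M N X = mat N N (\<lambda>(i, j). \<integral>\<omega>. X \<omega> $$ (i, j) \<partial>M)"

text \<open>The map \<open>\<Phi>\<close> for an ensemble of unitaries given as a random variable \<open>u\<close> on \<open>M\<close>.\<close>

definition second_moment_map ::
    "nat \<Rightarrow> 'a measure \<Rightarrow> ('a \<Rightarrow> complex mat) \<Rightarrow> complex mat \<Rightarrow> complex mat" where
  "second_moment_map n M u A =
     mat_expectation M (2 ^ n * 2 ^ n)
       (\<lambda>\<omega>. kron (u \<omega>) (u \<omega>) * A * mat_adjoint (kron (u \<omega>) (u \<omega>)))"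

definition haar_state_moment :: "nat \<Rightarrow> complex mat measure \<Rightarrow> complex mat" where
  "haar_state_moment n H =
     mat_expectation H (2 ^ n * 2 ^ n)
       (\<lambda>U. kron (ket_bra (U *\<^sub>v zero_state n)) (ket_bra (U *\<^sub>v zero_state n)))"

definition relative_state_2_design :: "nat \<Rightarrow> real \<Rightarrow> complex mat \<Rightarrow> bool" where
  "relative_state_2_design n \<epsilon> \<rho> \<longleftrightarrow> (\<exists>H. haar_USp n H \<and>
     loewner_le (complex_of_real (1 - \<epsilon>) \<cdot>\<^sub>m haar_state_moment n H) \<rho> \<and>
     loewner_le \<rho> (complex_of_real (1 + \<epsilon>) \<cdot>\<^sub>m haar_state_moment n H))"

subsection \<open>Local symplectic circuits\<close>

text \<open>
  \<open>Gate qs V\<close> applies \<open>V\<close> to the qubits listed in \<open>qs\<close>; bit \<open>i\<close> of an index of \<open>V\<close> belongs to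
  qubit \<open>qs ! i\<close>.  A circuit is the list of its layers, the layer applied first at the head.
\<close>

datatype gate = Gate (gate_qubits: "nat list") (gate_op: "complex mat")

type_synonym layer = "gate list"
type_synonym circuit = "layer list"

abbreviation gate_support :: "gate \<Rightarrow> nat set" where
  "gate_support g \<equiv> set (gate_qubits g)"

definition restrict_index :: "nat list \<Rightarrow> nat \<Rightarrow> nat" where
  "restrict_index qs x = horner_sum of_bool 2 (map (bit x) qs)"

definition gate_unitary :: "nat \<Rightarrow> gate \<Rightarrow> complex mat" where
  "gate_unitary n g = mat (2 ^ n) (2 ^ n) (\<lambda>(x, y).
     if \<forall>j < n. j \<notin> gate_support g \<longrightarrow> bit x j = bit y j
     then gate_op g $$ (restrict_index (gate_qubits g) x, restrict_index (gate_qubits g) y)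
     else 0)"

definition layer_unitary :: "nat \<Rightarrow> layer \<Rightarrow> complex mat" where
  "layer_unitary n L = fold (\<lambda>g U. gate_unitary n g * U) L (1\<^sub>m (2 ^ n))"

definition circuit_unitary :: "nat \<Rightarrow> circuit \<Rightarrow> complex mat" where
  "circuit_unitary n C = fold (\<lambda>L U. layer_unitary n L * U) C (1\<^sub>m (2 ^ n))"

text \<open>Architecture graphs on the qubits \<open>{..<n}\<close>, given by their symmetric adjacency relations.\<close>

definition architecture :: "nat \<Rightarrow> nat rel \<Rightarrow> bool" where
  "architecture n G \<longleftrightarrow> G \<subseteq> {..<n} \<times> {..<n} \<and> sym G \<and> irrefl G"

definition line_graph :: "nat \<Rightarrow> nat rel" where
  "line_graph n = {(i, j). i < n \<and> j < n \<and> (j = Suc i \<or> i = Suc j)}"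

definition ring_graph :: "nat \<Rightarrow> nat rel" where
  "ring_graph n = {(i, j). i < n \<and> j < n \<and> i \<noteq> j \<and> (j = Suc i mod n \<or> i = Suc j mod n)}"

definition all_to_all_graph :: "nat \<Rightarrow> nat rel" where
  "all_to_all_graph n = {(i, j). i < n \<and> j < n \<and> i \<noteq> j}"

text \<open>A gate is allowed by the architecture if its support induces a connected subgraph.\<close>

definition connected_in :: "nat rel \<Rightarrow> nat set \<Rightarrow> bool" where
  "connected_in G S \<longleftrightarrow> (\<forall>i \<in> S. \<forall>j \<in> S. (i, j) \<in> (G \<inter> S \<times> S)\<^sup>*)"

definition local_symplectic_gate :: "nat \<Rightarrow> nat rel \<Rightarrow> nat \<Rightarrow> gate \<Rightarrow> bool" where
  "local_symplectic_gate n G k g \<longleftrightarrow>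
     distinct (gate_qubits g) \<and> gate_support g \<subseteq> {..<n} \<and> connected_in G (gate_support g) \<and>
     (let r = length (gate_qubits g); V = gate_op g in
       r \<le> k \<and> V \<in> unitary_group (2 ^ r) \<and>
       V * kron_power pauli_Y r * transpose_mat V = kron_power pauli_Y r)"

definition local_symplectic_circuit :: "nat \<Rightarrow> nat rel \<Rightarrow> nat \<Rightarrow> circuit \<Rightarrow> bool" where
  "local_symplectic_circuit n G k C \<longleftrightarrow> (\<forall>L \<in> set C.
     (\<forall>g \<in> set L. local_symplectic_gate n G k g) \<and>
     sorted_wrt (\<lambda>g h. gate_support g \<inter> gate_support h = {}) L)"

text \<open>
  An ensemble is a probability measure on circuits.  Its \<open>\<sigma>\<close>-algebra is arbitrary, as long as the
  implemented unitary is a random variable.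
\<close>

definition symplectic_ensemble :: "nat \<Rightarrow> nat rel \<Rightarrow> nat \<Rightarrow> circuit measure \<Rightarrow> bool" where
  "symplectic_ensemble n G k E \<longleftrightarrow> prob_space E \<and>
     (\<forall>C \<in> space E. local_symplectic_circuit n G k C) \<and>
     (\<forall>i < 2 ^ n. \<forall>j < 2 ^ n. (\<lambda>C. circuit_unitary n C $$ (i, j)) \<in> borel_measurable E)"

definition has_depth :: "circuit measure \<Rightarrow> nat \<Rightarrow> bool" where
  "has_depth E d \<longleftrightarrow> d \<in> length ` space E \<and> (\<forall>C \<in> space E. length C \<le> d)"

definition state_2_design_ensemble :: "nat \<Rightarrow> real \<Rightarrow> circuit measure \<Rightarrow> bool" where
  "state_2_design_ensemble n \<epsilon> E \<longleftrightarrow> relative_state_2_design n \<epsilon>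
     (second_moment_map n E (circuit_unitary n)
        (kron (ket_bra (zero_state n)) (ket_bra (zero_state n))))"

subsection \<open>Lightcones\<close>

definition lightcone :: "circuit \<Rightarrow> nat \<Rightarrow> nat set" where
  "lightcone C q =
     fold (\<lambda>L S. S \<union> (\<Union>g \<in> {g \<in> set L. gate_support g \<inter> S \<noteq> {}}. gate_support g)) C {q}"

text \<open>
  The same lightcone, with the layers traversed from the output of the circuit to its input.
\<close>

definition backward_lightcone :: "circuit \<Rightarrow> nat \<Rightarrow> nat set" where
  "backward_lightcone C q = lightcone (rev C) q"

definition layout :: "circuit \<Rightarrow> nat set set list" where
  "layout C = map (\<lambda>L. gate_support ` set L) C"

text \<open>
  In an ensemble with one fixed layout the lightcones do not depend on the circuit.  If the layout
  is random as well, an ensemble stays a design after mixing in, with small probability, circuits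
  without any gates, so full lightcones can only be asked for with positive probability, written
  \<open>\<exists>\<^sub>F C in ae_filter E\<close>.  The circuit may depend on the qubit, and for random layouts the lightcone
  of a single circuit is taken in the direction of the Heisenberg evolution, from output to input.
\<close>

definition full_lightcones :: "nat \<Rightarrow> circuit measure \<Rightarrow> bool" where
  "full_lightcones n E \<longleftrightarrow>
     ((\<forall>C \<in> space E. \<forall>C' \<in> space E. layout C = layout C') \<longrightarrow>
        (\<forall>C \<in> space E. \<forall>q < n. {..<n} \<subseteq> lightcone C q)) \<and>
     (\<forall>q < n. \<exists>\<^sub>F C in ae_filter E. {..<n} \<subseteq> backward_lightcone C q) \<and>
     (\<forall>q < n. \<forall>p < n. \<exists>\<^sub>F C in ae_filter E. p \<in> lightcone C q)"

end

(*
  Evaluate the second moments on the quadratic form q(psi) = psi^T Y^(tensor n) Z_q psi, whose matrix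
  is symmetric and nonzero because n is odd.

  For a circuit U and a qubit p whose lightcone misses q, W = U Z_p U^* commutes with Z_q, and
  U^T Y^(tensor n) U = Y^(tensor n) gives psi^T Y^(tensor n) W = - psi^T Y^(tensor n) because
  Y anticommutes with Z; as W psi = psi, it follows that q(psi) = - q(psi), hence q(psi) = 0.

  If this happened almost surely, the lower Loewner bound would force q(psi) = 0 for almost every
  Haar-random psi, and by invariance also after applying finitely many fixed symplectic rotations.
  Rotations by pi/2 and pi/4 in the planes spanned by a basis state and its bitwise complement then
  annihilate all amplitudes of some unit vector psi.

  So every backward lightcone is full with positive probability, and the depth bounds follow from
  counting how many qubits a lightcone of depth d can contain.
*)

theory Submission
  imports Defs
begin

subsection \<open>Indices as bit strings\<close>

text \<open>Why odd n and why Z_q: as Y^T = -Y, the matrix Y^(tensor n) is antisymmetric for odd n,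
  so its own quadratic form is zero on every state and detects nothing. Z_q is symmetric and
  anticommutes with Y^(tensor n), which makes the product symmetric; for even n the form of
  Y^(tensor n) Z_q would vanish identically. The form is a linear functional of psi tensor psi, so
  the mean of its squared modulus is a quadratic form of the second moment, and the Loewner
  inequality compares these means for the two ensembles directly. The form depends on q but not on
  p. One almost-sure event therefore covers circuits that miss q from different starting qubits p,
  and its failure yields a single circuit in which q is reached from every p, that is, a full
  backward lightcone of q. Forward lightcones are obtained one target at a time, and for all targets
  at once when the layout is fixed.\<close>

definition of_bits :: "nat \<Rightarrow> (nat \<Rightarrow> bool) \<Rightarrow> nat" where
  "of_bits n P = horner_sum of_bool 2 (map P [0..<n])"

lemma bit_of_bits [simp]: "bit (of_bits n P) j \<longleftrightarrow> j < n \<and> P j"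
  unfolding of_bits_def by (auto simp: bit_horner_sum_bit_iff)

lemma of_bits_less [simp]: "of_bits n P < 2 ^ n"
  using horner_sum_of_bool_2_less[of "map P [0..<n]"] unfolding of_bits_def by simp

lemma bits_eqI:
  fixes x y :: nat
  assumes "x < 2 ^ n" "y < 2 ^ n" "\<And>j. j < n \<Longrightarrow> bit x j = bit y j"
  shows "x = y"
proof -
  have "take_bit n x = take_bit n y"
    using assms(3) by (intro bit_eqI) (auto simp: bit_take_bit_iff)
  then show ?thesis
    using assms(1,2) by (simp add: take_bit_nat_eq_self)
qed

lemma bit_restrict_index [simp]:
  "bit (restrict_index qs x) i \<longleftrightarrow> i < length qs \<and> bit x (qs ! i)"
  unfolding restrict_index_def by (auto simp: bit_horner_sum_bit_iff)

lemma restrict_index_less [simp]: "restrict_index qs x < 2 ^ length qs"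
  using horner_sum_of_bool_2_less[of "map (bit x) qs"] unfolding restrict_index_def by simp

lemma restrict_index_eq_iff:
  "restrict_index qs x = restrict_index qs y \<longleftrightarrow> (\<forall>j \<in> set qs. bit x j = bit y j)"
proof
  assume "restrict_index qs x = restrict_index qs y"
  then have "bit x (qs ! i) = bit y (qs ! i)" if "i < length qs" for i
    using that by (metis bit_restrict_index)
  then show "\<forall>j \<in> set qs. bit x j = bit y j" by (metis in_set_conv_nth)
next
  assume "\<forall>j \<in> set qs. bit x j = bit y j"
  then show "restrict_index qs x = restrict_index qs y"
    by (intro bits_eqI[of _ "length qs"]) auto
qed

text \<open>The section of \<open>restrict_index qs\<close> that keeps the bits of x outside qs. As
  a varies, its values are the columns in which row x of a gate on qs can be nonzero.\<close>

definition overwrite_index :: "nat \<Rightarrow> nat list \<Rightarrow> nat \<Rightarrow> nat \<Rightarrow> nat" where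
  "overwrite_index n qs x a = of_bits n
     (\<lambda>j. if j \<in> set qs then \<exists>i < length qs. qs ! i = j \<and> bit a i else bit x j)"

lemma overwrite_index_less [simp]: "overwrite_index n qs x a < 2 ^ n"
  by (simp add: overwrite_index_def)

lemma bit_overwrite_index_outside [simp]:
  "j < n \<Longrightarrow> j \<notin> set qs \<Longrightarrow> bit (overwrite_index n qs x a) j = bit x j"
  by (simp add: overwrite_index_def)

lemma bit_overwrite_index_nth [simp]:
  assumes "distinct qs" "set qs \<subseteq> {..<n}" "i < length qs"
  shows "bit (overwrite_index n qs x a) (qs ! i) = bit a i"
proof -
  have "qs ! i < n" using assms by (meson lessThan_iff nth_mem subsetD)
  then show ?thesis
    using assms by (auto simp: overwrite_index_def nth_eq_iff_index_eq)
qed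

lemma restrict_overwrite_index [simp]:
  assumes "distinct qs" "set qs \<subseteq> {..<n}" "a < 2 ^ length qs"
  shows "restrict_index qs (overwrite_index n qs x a) = a"
  using assms by (intro bits_eqI[of _ "length qs"]) auto

lemma overwrite_restrict_index:
  assumes "distinct qs" "set qs \<subseteq> {..<n}" "u < 2 ^ n"
    and "\<forall>j < n. j \<notin> set qs \<longrightarrow> bit x j = bit u j"
  shows "overwrite_index n qs x (restrict_index qs u) = u"
proof (rule bits_eqI[of _ n])
  fix j assume "j < n"
  show "bit (overwrite_index n qs x (restrict_index qs u)) j = bit u j"
  proof (cases "j \<in> set qs")
    case True
    then obtain i where "i < length qs" "qs ! i = j" by (auto simp: in_set_conv_nth)
    then show ?thesis
      using bit_overwrite_index_nth[OF assms(1,2), of i x "restrict_index qs u"] by simp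
  qed (use assms \<open>j < n\<close> in auto)
qed (use assms in auto)

text \<open>The columns that agree with x off qs correspond bijectively to the indices a of the
  small matrix. Sums of length 2^n over a gate row thus become sums over local indices, where the
  hypotheses on the gate operator apply.\<close>

lemma sum_gate_row:
  fixes c h :: "nat \<Rightarrow> complex"
  assumes "distinct qs" "set qs \<subseteq> {..<n}"
  shows "(\<Sum>u < 2 ^ n. (if \<forall>j < n. j \<notin> set qs \<longrightarrow> bit x j = bit u j
            then c (restrict_index qs u) else 0) * h u)
       = (\<Sum>a < 2 ^ length qs. c a * h (overwrite_index n qs x a))"
proof -
  let ?A = "{u \<in> {..<2 ^ n}. \<forall>j < n. j \<notin> set qs \<longrightarrow> bit x j = bit u j}"
  have "(\<Sum>u < 2 ^ n. (if \<forall>j < n. j \<notin> set qs \<longrightarrow> bit x j = bit u j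
            then c (restrict_index qs u) else 0) * h u)
      = (\<Sum>u \<in> ?A. c (restrict_index qs u) * h u)"
    by (subst sum.inter_filter) (auto intro!: sum.cong)
  also have "\<dots> = (\<Sum>a < 2 ^ length qs. c a * h (overwrite_index n qs x a))"
    using assms
    by (intro sum.reindex_bij_witness[of _ "overwrite_index n qs x" "restrict_index qs"])
       (auto simp: overwrite_restrict_index)
  finally show ?thesis .
qed

subsection \<open>Tensor powers of the Pauli matrix\<close>

definition pauli_Y_entry :: "bool \<Rightarrow> bool \<Rightarrow> complex" where
  "pauli_Y_entry s t = (if s = t then 0 else if s then \<i> else - \<i>)"

abbreviation Y_power :: "nat \<Rightarrow> complex mat" where
  "Y_power \<equiv> kron_power pauli_Y"

lemma pauli_Y_carrier: "pauli_Y \<in> carrier_mat 2 2"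
  unfolding pauli_Y_def mat_of_rows_list_def by auto

lemma pauli_Y_index: "pauli_Y $$ (of_bool s, of_bool t) = pauli_Y_entry s t"
  unfolding pauli_Y_def mat_of_rows_list_def pauli_Y_entry_def by (cases s; cases t) auto

lemma Y_power_carrier [simp]: "Y_power r \<in> carrier_mat (2 ^ r) (2 ^ r)"
  using pauli_Y_carrier by (induction r) (auto simp: kron_def)

lemma Y_power_dim [simp]: "dim_row (Y_power r) = 2 ^ r" "dim_col (Y_power r) = 2 ^ r"
  using Y_power_carrier[of r] by (auto simp del: Y_power_carrier)

lemma div_power_eq_of_bool_bit:
  fixes a :: nat
  assumes "a < 2 ^ Suc r"
  shows "a div 2 ^ r = of_bool (bit a r)"
proof -
  have "a div 2 ^ r < 2" using assms by (simp add: less_mult_imp_div_less)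
  then show ?thesis by (auto simp: bit_iff_odd less_2_cases_iff)
qed

text \<open>\<open>kron\<close> puts the new factor into the most significant bit, so the recursion
  on r peels off bit r.\<close>

lemma Y_power_index:
  "a < 2 ^ r \<Longrightarrow> b < 2 ^ r \<Longrightarrow>
     Y_power r $$ (a, b) = (\<Prod>i < r. pauli_Y_entry (bit a i) (bit b i))"
proof (induction r arbitrary: a b)
  case (Suc r)
  have bits: "bit (x mod 2 ^ r) i = bit x i" if "i < r" for x i :: nat
    using that by (simp add: bit_take_bit_iff flip: take_bit_eq_mod)
  have "Y_power (Suc r) $$ (a, b)
      = pauli_Y $$ (a div 2 ^ r, b div 2 ^ r) * Y_power r $$ (a mod 2 ^ r, b mod 2 ^ r)"
    using Suc.prems pauli_Y_carrier by (simp add: kron_def)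
  also have "\<dots> = pauli_Y_entry (bit a r) (bit b r) * (\<Prod>i < r. pauli_Y_entry (bit a i) (bit b i))"
    using Suc.prems
    by (subst Suc.IH) (auto simp: div_power_eq_of_bool_bit pauli_Y_index bits intro!: prod.cong)
  finally show ?case by (simp add: mult.commute)
qed auto

definition complement_index :: "nat \<Rightarrow> nat \<Rightarrow> nat" where
  "complement_index n x = of_bits n (\<lambda>j. \<not> bit x j)"

lemma complement_index_less [simp]: "complement_index n x < 2 ^ n"
  by (simp add: complement_index_def)

lemma bit_complement_index [simp]:
  "bit (complement_index n x) j \<longleftrightarrow> j < n \<and> \<not> bit x j"
  by (simp add: complement_index_def)

lemma complement_complement_index [simp]:
  "x < 2 ^ n \<Longrightarrow> complement_index n (complement_index n x) = x"
  by (rule bits_eqI[of _ n]) auto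

lemma complement_index_neq: "0 < n \<Longrightarrow> complement_index n x \<noteq> x"
  by (metis bit_complement_index)

text \<open>The only nonzero entry in row x of \<open>Y_power n\<close>; it stands in column
  \<open>complement_index n x\<close>.\<close>

definition Y_sign :: "nat \<Rightarrow> nat \<Rightarrow> complex" where
  "Y_sign n x = (\<Prod>i < n. if bit x i then \<i> else - \<i>)"

text \<open>The diagonal of \<open>pauli_Y\<close> is zero, so a single bit shared by x and y kills
  the product: the tensor power is a permutation matrix with phases.\<close>

lemma Y_power_index_complement:
  assumes "x < 2 ^ n" "y < 2 ^ n"
  shows "Y_power n $$ (x, y) = (if y = complement_index n x then Y_sign n x else 0)"
proof (cases "y = complement_index n x")
  case True
  then show ?thesis
    using assms by (auto simp: Y_power_index Y_sign_def pauli_Y_entry_def intro!: prod.cong)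
next
  case False
  then obtain j where "j < n" "bit y j = bit x j"
    using assms bits_eqI[of y n "complement_index n x"] by auto
  then have "\<exists>i \<in> {..<n}. pauli_Y_entry (bit x i) (bit y i) = 0"
    by (auto simp: pauli_Y_entry_def)
  then show ?thesis
    using assms False by (simp add: Y_power_index)
qed

lemma Y_sign_nonzero [simp]: "Y_sign n x \<noteq> 0"
  by (auto simp: Y_sign_def)

text \<open>Flipping a bit exchanges i and -i, one factor -1 per qubit. For odd n this is the
  antisymmetry of \<open>Y_power n\<close>.\<close>

lemma Y_sign_complement: "Y_sign n (complement_index n x) = (- 1) ^ n * Y_sign n x"
proof -
  have "Y_sign n (complement_index n x) = (\<Prod>i < n. (- 1) * (if bit x i then \<i> else - \<i>))"
    unfolding Y_sign_def by (intro prod.cong) auto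
  also have "\<dots> = (- 1) ^ n * Y_sign n x"
    unfolding Y_sign_def prod.distrib by simp
  finally show ?thesis .
qed

lemma Y_sign_mult_complement: "Y_sign n x * Y_sign n (complement_index n x) = 1"
proof -
  have "Y_sign n x * Y_sign n (complement_index n x)
      = (\<Prod>i < n. (if bit x i then \<i> else - \<i>) * (if bit x i then - \<i> else \<i>))"
    unfolding Y_sign_def prod.distrib by (intro arg_cong2[where f = "(*)"] prod.cong) auto
  also have "\<dots> = (\<Prod>i < n. 1)"
    by (intro prod.cong) auto
  finally show ?thesis by simp
qed

lemma mat_mult_index:
  fixes A B :: "complex mat"
  assumes "A \<in> carrier_mat a b" "B \<in> carrier_mat b c" "i < a" "j < c"
  shows "(A * B) $$ (i, j) = (\<Sum>k < b. A $$ (i, k) * B $$ (k, j))"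
  using assms by (auto simp: scalar_prod_def atLeast0LessThan)

lemma Y_power_mult_index:
  assumes "A \<in> carrier_mat (2 ^ n) m" "x < 2 ^ n" "y < m"
  shows "(Y_power n * A) $$ (x, y) = Y_sign n x * A $$ (complement_index n x, y)"
proof -
  have "(Y_power n * A) $$ (x, y) = (\<Sum>u < 2 ^ n. Y_power n $$ (x, u) * A $$ (u, y))"
    using assms by (auto simp: scalar_prod_def atLeast0LessThan)
  also have "\<dots> = (\<Sum>u < 2 ^ n. if u = complement_index n x then Y_sign n x * A $$ (u, y) else 0)"
    using assms by (intro sum.cong) (auto simp: Y_power_index_complement)
  finally show ?thesis by simp
qed

lemma Y_power_square: "Y_power n * Y_power n = 1\<^sub>m (2 ^ n)"
proof (rule eq_matI)
  fix x y assume "x < dim_row (1\<^sub>m (2 ^ n) :: complex mat)" "y < dim_col (1\<^sub>m (2 ^ n) :: complex mat)"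
  then have "x < 2 ^ n" "y < 2 ^ n" by auto
  then show "(Y_power n * Y_power n) $$ (x, y) = 1\<^sub>m (2 ^ n) $$ (x, y)"
    by (subst Y_power_mult_index[of _ _ "2 ^ n"])
       (auto simp: Y_power_index_complement Y_sign_mult_complement)
qed auto

subsection \<open>The unitary symplectic group\<close>

lemma mat_adjoint_dim [simp]:
  "dim_row (mat_adjoint A) = dim_col A" "dim_col (mat_adjoint A) = dim_row A"
  unfolding mat_adjoint_def by auto

lemma mat_adjoint_carrier: "A \<in> carrier_mat n m \<Longrightarrow> mat_adjoint A \<in> carrier_mat m n"
  by auto

lemma mat_adjoint_index:
  "A \<in> carrier_mat n m \<Longrightarrow> i < m \<Longrightarrow> j < n \<Longrightarrow> mat_adjoint A $$ (i, j) = cnj (A $$ (j, i))"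
  for A :: "complex mat"
  unfolding mat_adjoint_def by (auto simp: mat_of_rows_index conjugate_complex_def)

lemma mat_adjoint_mult:
  fixes A B :: "complex mat"
  assumes "A \<in> carrier_mat n n" "B \<in> carrier_mat n n"
  shows "mat_adjoint (A * B) = mat_adjoint B * mat_adjoint A"
proof (rule eq_matI)
  fix i j assume "i < dim_row (mat_adjoint B * mat_adjoint A)" "j < dim_col (mat_adjoint B * mat_adjoint A)"
  then have ij: "i < n" "j < n" using assms by auto
  have AB: "A * B \<in> carrier_mat n n" using assms by auto
  have c: "mat_adjoint A \<in> carrier_mat n n" "mat_adjoint B \<in> carrier_mat n n"
    using assms by (auto intro: mat_adjoint_carrier)
  show "mat_adjoint (A * B) $$ (i, j) = (mat_adjoint B * mat_adjoint A) $$ (i, j)"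
    unfolding mat_adjoint_index[OF AB ij]
    using assms ij c mat_adjoint_index[OF assms(1)] mat_adjoint_index[OF assms(2)]
    by (auto simp: scalar_prod_def mult.commute intro!: sum.cong)
next
  show "dim_row (mat_adjoint (A * B)) = dim_row (mat_adjoint B * mat_adjoint A)"
       "dim_col (mat_adjoint (A * B)) = dim_col (mat_adjoint B * mat_adjoint A)"
    using assms by auto
qed

text \<open>Orthonormal rows give a right inverse, and for square matrices a right inverse is also a
  left inverse.\<close>

lemma unitary_groupI:
  assumes "U \<in> carrier_mat N N"
    and "\<And>i j. i < N \<Longrightarrow> j < N \<Longrightarrow> (\<Sum>k < N. U $$ (i, k) * cnj (U $$ (j, k))) = (if i = j then 1 else 0)"
  shows "U \<in> unitary_group N"
proof -
  have c: "mat_adjoint U \<in> carrier_mat N N" using assms(1) by (rule mat_adjoint_carrier)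
  have "U * mat_adjoint U = 1\<^sub>m N"
    using assms c by (intro eq_matI) (auto simp: scalar_prod_def mat_adjoint_index atLeast0LessThan)
  with mat_mult_left_right_inverse[OF assms(1) c] assms(1) show ?thesis
    unfolding unitary_group_def by auto
qed

lemma unitary_group_row_orthonormal:
  assumes "U \<in> unitary_group N" "i < N" "j < N"
  shows "(\<Sum>k < N. U $$ (i, k) * cnj (U $$ (j, k))) = (if i = j then 1 else 0)"
proof -
  have c: "U \<in> carrier_mat N N" and u: "U * mat_adjoint U = 1\<^sub>m N"
    using assms unfolding unitary_group_def by auto
  have c': "mat_adjoint U \<in> carrier_mat N N" using c by (rule mat_adjoint_carrier)
  have "(U * mat_adjoint U) $$ (i, j) = (\<Sum>k < N. U $$ (i, k) * cnj (U $$ (j, k)))"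
    using assms c c' by (auto simp: scalar_prod_def mat_adjoint_index[OF c] atLeast0LessThan)
  then show ?thesis using assms u by simp
qed

text \<open>Each row is a unit vector. The bound later makes products of amplitudes
  integrable.\<close>

lemma unitary_group_entry_le_1:
  assumes "U \<in> unitary_group N" "i < N" "j < N"
  shows "cmod (U $$ (i, j)) \<le> 1"
proof -
  have "complex_of_real (\<Sum>k < N. (cmod (U $$ (i, k)))\<^sup>2) = 1"
    using unitary_group_row_orthonormal[OF assms(1,2,2)] by (simp add: complex_norm_square del: of_real_power)
  then have "(\<Sum>k < N. (cmod (U $$ (i, k)))\<^sup>2) = 1" using of_real_eq_1_iff by blast
  then have "(cmod (U $$ (i, j)))\<^sup>2 \<le> 1"
    using member_le_sum[of j "{..<N}" "\<lambda>k. (cmod (U $$ (i, k)))\<^sup>2"] assms(3) by simp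
  then show ?thesis by (simp add: power2_le_iff_abs_le abs_square_le_1)
qed

text \<open>Column 0 is the state U|0>; that it cannot vanish is the contradiction at the end of the
  Haar argument.\<close>

lemma unitary_group_col_nonzero:
  assumes "U \<in> unitary_group N" "j < N"
  shows "\<exists>i < N. U $$ (i, j) \<noteq> 0"
proof (rule ccontr)
  assume zero: "\<not> (\<exists>i < N. U $$ (i, j) \<noteq> 0)"
  have c: "U \<in> carrier_mat N N" and u: "mat_adjoint U * U = 1\<^sub>m N"
    using assms unfolding unitary_group_def by auto
  have "(mat_adjoint U * U) $$ (j, j) = (\<Sum>k < N. mat_adjoint U $$ (j, k) * U $$ (k, j))"
    using assms c by (auto simp: scalar_prod_def atLeast0LessThan)
  also have "\<dots> = 0" using zero by auto
  finally show False using u assms by simp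
qed

lemma unitary_group_mult:
  assumes "A \<in> unitary_group N" "B \<in> unitary_group N"
  shows "A * B \<in> unitary_group N"
proof -
  note assoc = assoc_mult_mat[of _ N N _ N _ N] mult_carrier_mat[of _ N N _ N]
  have c: "A \<in> carrier_mat N N" "B \<in> carrier_mat N N"
    and u: "A * mat_adjoint A = 1\<^sub>m N" "B * mat_adjoint B = 1\<^sub>m N"
    using assms unfolding unitary_group_def by auto
  have c': "mat_adjoint A \<in> carrier_mat N N" "mat_adjoint B \<in> carrier_mat N N"
    using c by auto
  have AB: "A * B \<in> carrier_mat N N" using c by auto
  have "A * B * mat_adjoint (A * B) = A * (B * mat_adjoint B) * mat_adjoint A"
    unfolding mat_adjoint_mult[OF c] using c c' by (simp add: assoc)
  also have "\<dots> = 1\<^sub>m N" using u c c' by simp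
  finally have "A * B * mat_adjoint (A * B) = 1\<^sub>m N" .
  with mat_mult_left_right_inverse[OF AB mat_adjoint_carrier[OF AB]] AB show ?thesis
    unfolding unitary_group_def by auto
qed

text \<open>Membership in \<open>USp n\<close> with the phase i^n dropped, so that gates and whole
  circuits obey the same equation.\<close>

definition symplectic_group :: "nat \<Rightarrow> complex mat set" where
  "symplectic_group n =
     {U \<in> unitary_group (2 ^ n). U * Y_power n * transpose_mat U = Y_power n}"

lemma symplectic_group_carrier: "U \<in> symplectic_group n \<Longrightarrow> U \<in> carrier_mat (2 ^ n) (2 ^ n)"
  unfolding symplectic_group_def unitary_group_def by auto

lemma USp_eq_symplectic_group: "USp n = symplectic_group n"
proof -
  have "U * J_form n * transpose_mat U = J_form n \<longleftrightarrow> U * Y_power n * transpose_mat U = Y_power n"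
    if "U \<in> unitary_group (2 ^ n)" for U
  proof -
    have c: "U \<in> carrier_mat (2 ^ n) (2 ^ n)" using that unfolding unitary_group_def by auto
    have "U * J_form n * transpose_mat U = \<i> ^ n \<cdot>\<^sub>m (U * Y_power n * transpose_mat U)"
      unfolding J_form_def using c
      by (simp add: mult_smult_distrib[OF c Y_power_carrier]
          mult_smult_assoc_mat[of _ "2 ^ n" "2 ^ n" _ "2 ^ n"])
    moreover have "\<i> ^ n \<cdot>\<^sub>m A = \<i> ^ n \<cdot>\<^sub>m B \<longleftrightarrow> A = B" for A B :: "complex mat"
    proof
      assume "\<i> ^ n \<cdot>\<^sub>m A = \<i> ^ n \<cdot>\<^sub>m B"
      then show "A = B" by (auto simp: mat_eq_iff)
    qed simp
    ultimately show ?thesis unfolding J_form_def by simp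
  qed
  then show ?thesis unfolding USp_def symplectic_group_def by auto
qed

lemma one_symplectic_group: "1\<^sub>m (2 ^ n) \<in> symplectic_group n"
  unfolding symplectic_group_def
  by (auto intro!: unitary_groupI simp: if_distrib[of cnj] if_distrib[of "\<lambda>x. _ * x"] cong: if_cong)

lemma symplectic_group_mult:
  assumes "A \<in> symplectic_group n" "B \<in> symplectic_group n"
  shows "A * B \<in> symplectic_group n"
proof -
  let ?N = "2 ^ n :: nat"
  have c: "A \<in> carrier_mat ?N ?N" "B \<in> carrier_mat ?N ?N"
    using assms symplectic_group_carrier by auto
  note assoc = assoc_mult_mat[of _ ?N ?N _ ?N _ ?N] mult_carrier_mat[of _ ?N ?N _ ?N]
  have "A * B * Y_power n * transpose_mat (A * B)
      = A * (B * Y_power n * transpose_mat B) * transpose_mat A"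
    using c by (simp add: transpose_mult[OF c] assoc)
  also have "\<dots> = Y_power n"
    using assms unfolding symplectic_group_def by simp
  finally show ?thesis
    using assms unitary_group_mult unfolding symplectic_group_def by auto
qed

text \<open>Solving U Y U^T = Y gives U^T = Y U^-1 Y, as Y squares to 1. In this form the transpose
  in a quadratic form becomes an inverse, which can meet a Heisenberg-evolved operator.\<close>

lemma symplectic_group_transpose_Y:
  assumes "U \<in> symplectic_group n"
  shows "transpose_mat U * Y_power n = Y_power n * mat_adjoint U"
proof -
  let ?N = "2 ^ n :: nat" and ?Y = "Y_power n" and ?V = "mat_adjoint U" and ?T = "transpose_mat U"
  have c: "U \<in> carrier_mat ?N ?N" and u: "?V * U = 1\<^sub>m ?N" and s: "U * ?Y * ?T = ?Y"
    using assms unfolding symplectic_group_def unitary_group_def by auto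
  have c': "?V \<in> carrier_mat ?N ?N" "?T \<in> carrier_mat ?N ?N" using c by auto
  note assoc = assoc_mult_mat[of _ ?N ?N _ ?N _ ?N] mult_carrier_mat[of _ ?N ?N _ ?N]
  \<comment> \<open>The last factor Y is expanded as U Y U^T, after which U^-1 U and Y Y
    cancel.\<close>
  have "?Y * ?V * ?Y = ?Y * ?V * (U * ?Y * ?T)" using s by simp
  also have "\<dots> = ?Y * ((?V * U) * (?Y * ?T))" using c c' by (simp add: assoc)
  also have "\<dots> = ?Y * (?Y * ?T)" unfolding u using c' by simp
  also have "\<dots> = (?Y * ?Y) * ?T" using c c' by (simp add: assoc)
  also have "\<dots> = ?T" using c' by (simp add: Y_power_square)
  finally have "?T * ?Y = ?Y * ?V * ?Y * ?Y" by simp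
  also have "\<dots> = ?Y * ?V * (?Y * ?Y)" using c' by (simp add: assoc)
  also have "\<dots> = ?Y * ?V" using c' by (simp add: Y_power_square)
  finally show ?thesis .
qed

subsection \<open>Gates are symplectic\<close>

lemma mat_sandwich_transpose_index:
  fixes A B :: "complex mat"
  assumes "A \<in> carrier_mat N N" "B \<in> carrier_mat N N" "x < N" "y < N"
  shows "(A * B * transpose_mat A) $$ (x, y)
       = (\<Sum>u < N. A $$ (x, u) * (\<Sum>v < N. A $$ (y, v) * B $$ (u, v)))"
proof -
  have "(A * B * transpose_mat A) $$ (x, y) = (A * (B * transpose_mat A)) $$ (x, y)"
    using assms by (simp add: assoc_mult_mat[of _ N N _ N _ N])
  also have "\<dots> = (\<Sum>u < N. A $$ (x, u) * (\<Sum>v < N. A $$ (y, v) * B $$ (u, v)))"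
    using assms by (auto simp: scalar_prod_def atLeast0LessThan mult.commute intro!: sum.cong)
  finally show ?thesis .
qed

text \<open>The tensor power factors over the qubits in qs and the remaining ones. All tensor
  factors being equal, the order in which qs lists its qubits does not change the value.\<close>

lemma Y_power_restrict:
  assumes "distinct qs" "set qs \<subseteq> {..<n}" "x < 2 ^ n" "y < 2 ^ n"
  shows "Y_power n $$ (x, y)
       = Y_power (length qs) $$ (restrict_index qs x, restrict_index qs y)
         * (\<Prod>j \<in> {..<n} - set qs. pauli_Y_entry (bit x j) (bit y j))"
proof -
  have "(\<Prod>j < n. pauli_Y_entry (bit x j) (bit y j))
      = (\<Prod>j \<in> {..<n} - set qs. pauli_Y_entry (bit x j) (bit y j))
        * (\<Prod>j \<in> set qs. pauli_Y_entry (bit x j) (bit y j))"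
    using assms by (intro prod.subset_diff) auto
  moreover have "(\<Prod>i < length qs. pauli_Y_entry (bit x (qs ! i)) (bit y (qs ! i)))
      = (\<Prod>j \<in> set qs. pauli_Y_entry (bit x j) (bit y j))"
    using assms by (intro prod.reindex_bij_betw bij_betw_nth) auto
  ultimately show ?thesis
    using assms by (simp add: Y_power_index mult.commute)
qed

lemma gate_unitary_carrier [simp]: "gate_unitary n g \<in> carrier_mat (2 ^ n) (2 ^ n)"
  unfolding gate_unitary_def by auto

lemma gate_unitary_dim [simp]:
  "dim_row (gate_unitary n g) = 2 ^ n" "dim_col (gate_unitary n g) = 2 ^ n"
  unfolding gate_unitary_def by auto

lemma sum_gate_unitary_row:
  assumes "distinct (gate_qubits g)" "gate_support g \<subseteq> {..<n}" "x < 2 ^ n"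
  shows "(\<Sum>u < 2 ^ n. gate_unitary n g $$ (x, u) * h u)
       = (\<Sum>a < 2 ^ length (gate_qubits g).
            gate_op g $$ (restrict_index (gate_qubits g) x, a)
            * h (overwrite_index n (gate_qubits g) x a))"
  using assms
  by (subst sum_gate_row[symmetric]) (auto simp: gate_unitary_def intro!: sum.cong)

text \<open>On the qubits of the gate both conditions are the hypotheses on V; elsewhere the gate is
  the identity, which preserves orthonormality and the remaining tensor factors of Y.\<close>

lemma gate_unitary_symplectic:
  assumes "local_symplectic_gate n G k g"
  shows "gate_unitary n g \<in> symplectic_group n"
proof -
  define qs V where "qs = gate_qubits g" and "V = gate_op g"
  have qs: "distinct qs" "set qs \<subseteq> {..<n}"
    and V: "V \<in> unitary_group (2 ^ length qs)"
      "V * Y_power (length qs) * transpose_mat V = Y_power (length qs)"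
    using assms unfolding local_symplectic_gate_def by (auto simp: qs_def V_def Let_def)
  have Vc: "V \<in> carrier_mat (2 ^ length qs) (2 ^ length qs)"
    using V unfolding unitary_group_def by auto
  note row = sum_gate_unitary_row[of g n, folded qs_def V_def, OF qs]
  let ?r = "restrict_index qs" and ?R = "2 ^ length qs :: nat"
  have "gate_unitary n g \<in> unitary_group (2 ^ n)"
  proof (rule unitary_groupI)
    fix x y :: nat assume xy: "x < 2 ^ n" "y < 2 ^ n"
    \<comment> \<open>Rows that differ off the support have no common nonzero column, so only
      agreeing rows reach the orthonormality of the rows of V.\<close>
    define agree where "agree \<longleftrightarrow> (\<forall>j < n. j \<notin> set qs \<longrightarrow> bit y j = bit x j)"
    have "gate_unitary n g $$ (y, overwrite_index n qs x a) = (if agree then V $$ (?r y, a) else 0)"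
      if "a < ?R" for a
      using that xy qs unfolding gate_unitary_def qs_def[symmetric] V_def[symmetric] agree_def by auto
    then have "(\<Sum>u < 2 ^ n. gate_unitary n g $$ (x, u) * cnj (gate_unitary n g $$ (y, u)))
        = (\<Sum>a < ?R. V $$ (?r x, a) * cnj (if agree then V $$ (?r y, a) else 0))"
      unfolding row[OF xy(1)] by (intro sum.cong) auto
    also have "\<dots> = (if agree \<and> ?r x = ?r y then 1 else 0)"
      using unitary_group_row_orthonormal[OF V(1), of "?r x" "?r y"]
      by (cases agree) simp_all
    also have "agree \<and> ?r x = ?r y \<longleftrightarrow> x = y"
      using xy bits_eqI[of x n y] by (auto simp: restrict_index_eq_iff agree_def)
    finally show "(\<Sum>u < 2 ^ n. gate_unitary n g $$ (x, u) * cnj (gate_unitary n g $$ (y, u)))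
        = (if x = y then 1 else 0)" .
  qed auto
  moreover have "gate_unitary n g * Y_power n * transpose_mat (gate_unitary n g) = Y_power n"
  proof (rule eq_matI)
    fix x y assume "x < dim_row (Y_power n)" "y < dim_col (Y_power n)"
    then have xy: "x < 2 ^ n" "y < 2 ^ n" by auto
    \<comment> \<open>Overwriting leaves the bits off qs alone, so this factor is the same for all a
      and b and comes out of the double sum.\<close>
    define rest where "rest = (\<Prod>j \<in> {..<n} - set qs. pauli_Y_entry (bit x j) (bit y j))"
    have Y: "Y_power n $$ (overwrite_index n qs x a, overwrite_index n qs y b)
        = rest * Y_power (length qs) $$ (a, b)" if "a < ?R" "b < ?R" for a b
      using that qs
      by (subst Y_power_restrict[OF qs]) (auto simp: rest_def intro!: prod.cong)
    have "(gate_unitary n g * Y_power n * transpose_mat (gate_unitary n g)) $$ (x, y)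
        = (\<Sum>a < ?R. V $$ (?r x, a) * (\<Sum>b < ?R. V $$ (?r y, b) *
             Y_power n $$ (overwrite_index n qs x a, overwrite_index n qs y b)))"
      using xy by (subst mat_sandwich_transpose_index[of _ "2 ^ n"]) (auto simp: row)
    also have "\<dots> = (\<Sum>a < ?R. V $$ (?r x, a) * (\<Sum>b < ?R. V $$ (?r y, b) *
             (rest * Y_power (length qs) $$ (a, b))))"
      by (intro sum.cong refl arg_cong2[where f = "(*)"]) (auto simp: Y)
    also have "\<dots> = rest * (V * Y_power (length qs) * transpose_mat V) $$ (?r x, ?r y)"
      by (subst mat_sandwich_transpose_index[OF Vc])
         (auto simp: sum_distrib_left mult_ac)
    also have "\<dots> = Y_power n $$ (x, y)"
      unfolding V(2) using xy by (subst Y_power_restrict[OF qs]) (auto simp: rest_def)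
    finally show "(gate_unitary n g * Y_power n * transpose_mat (gate_unitary n g)) $$ (x, y)
        = Y_power n $$ (x, y)" .
  next
    show "dim_row (gate_unitary n g * Y_power n * transpose_mat (gate_unitary n g)) = dim_row (Y_power n)"
      "dim_col (gate_unitary n g * Y_power n * transpose_mat (gate_unitary n g)) = dim_col (Y_power n)"
      by simp_all
  qed
  ultimately show ?thesis unfolding symplectic_group_def by auto
qed

lemma fold_layer_symplectic:
  assumes "\<forall>g \<in> set L. local_symplectic_gate n G k g" "U \<in> symplectic_group n"
  shows "fold (\<lambda>g U. gate_unitary n g * U) L U \<in> symplectic_group n"
  using assms
  by (induction L arbitrary: U) (auto intro!: symplectic_group_mult gate_unitary_symplectic)

lemma layer_unitary_symplectic:
  assumes "\<forall>g \<in> set L. local_symplectic_gate n G k g"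
  shows "layer_unitary n L \<in> symplectic_group n"
  unfolding layer_unitary_def by (intro fold_layer_symplectic[OF assms] one_symplectic_group)

lemma circuit_unitary_symplectic:
  assumes "local_symplectic_circuit n G k C"
  shows "circuit_unitary n C \<in> symplectic_group n"
proof -
  have layers: "\<forall>L \<in> set C. layer_unitary n L \<in> symplectic_group n"
    using assms layer_unitary_symplectic unfolding local_symplectic_circuit_def by auto
  have "fold (\<lambda>L U. layer_unitary n L * U) C U \<in> symplectic_group n"
    if "\<forall>L \<in> set C. layer_unitary n L \<in> symplectic_group n" "U \<in> symplectic_group n" for U
    using that by (induction C arbitrary: U) (auto intro!: symplectic_group_mult)
  from this[OF layers one_symplectic_group] show ?thesis
    unfolding circuit_unitary_def .
qed

subsection \<open>Supports of operators\<close>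

text \<open>A is an operator on the qubits in S tensored with the identity. Expressing this through
  entries avoids reordering tensor factors: entries vanish unless the bits off S agree, and
  otherwise depend only on the bits in S.\<close>

definition supported_on :: "nat \<Rightarrow> nat set \<Rightarrow> complex mat \<Rightarrow> bool" where
  "supported_on n S A \<longleftrightarrow> A \<in> carrier_mat (2 ^ n) (2 ^ n) \<and>
     (\<forall>x < 2 ^ n. \<forall>y < 2 ^ n. A $$ (x, y) \<noteq> 0 \<longrightarrow> (\<forall>j < n. j \<notin> S \<longrightarrow> bit x j = bit y j)) \<and>
     (\<forall>x < 2 ^ n. \<forall>y < 2 ^ n. \<forall>x' < 2 ^ n. \<forall>y' < 2 ^ n.
        (\<forall>j < n. if j \<in> S then bit x j = bit x' j \<and> bit y j = bit y' j
                 else bit x j = bit y j \<and> bit x' j = bit y' j) \<longrightarrow>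
        A $$ (x, y) = A $$ (x', y'))"

lemma supported_on_carrier: "supported_on n S A \<Longrightarrow> A \<in> carrier_mat (2 ^ n) (2 ^ n)"
  unfolding supported_on_def by auto

lemma supported_on_nonzero:
  "supported_on n S A \<Longrightarrow> A $$ (x, y) \<noteq> 0 \<Longrightarrow> x < 2 ^ n \<Longrightarrow> y < 2 ^ n \<Longrightarrow>
     j < n \<Longrightarrow> j \<notin> S \<Longrightarrow> bit x j = bit y j"
  unfolding supported_on_def by blast

lemma supported_on_cong:
  assumes "supported_on n S A" "x < 2 ^ n" "y < 2 ^ n" "x' < 2 ^ n" "y' < 2 ^ n"
    and "\<And>j. j < n \<Longrightarrow> j \<in> S \<Longrightarrow> bit x j = bit x' j \<and> bit y j = bit y' j"
    and "\<And>j. j < n \<Longrightarrow> j \<notin> S \<Longrightarrow> bit x j = bit y j \<and> bit x' j = bit y' j"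
  shows "A $$ (x, y) = A $$ (x', y')"
proof -
  have "\<forall>j < n. if j \<in> S then bit x j = bit x' j \<and> bit y j = bit y' j
                 else bit x j = bit y j \<and> bit x' j = bit y' j"
    using assms(6,7) by simp
  with assms(1-5) show ?thesis unfolding supported_on_def by blast
qed

text \<open>In a path x, y, z the first factor changes only bits in S and the second only bits in T.
  With S and T disjoint, y must carry the bits of z on S and those of x elsewhere, so one term
  survives.\<close>

lemma supported_on_mult_index:
  assumes A: "supported_on n S A" and B: "supported_on n T B" and disj: "S \<inter> T = {}"
    and xz: "x < 2 ^ n" "z < 2 ^ n"
    and m: "m = of_bits n (\<lambda>j. if j \<in> S then bit z j else bit x j)"
  shows "(A * B) $$ (x, z) = A $$ (x, m) * B $$ (m, z)"
proof -
  have "A $$ (x, y) * B $$ (y, z) = 0" if "y < 2 ^ n" "y \<noteq> m" for y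
  proof (rule ccontr)
    assume "A $$ (x, y) * B $$ (y, z) \<noteq> 0"
    then have "A $$ (x, y) \<noteq> 0" "B $$ (y, z) \<noteq> 0" by auto
    then have "bit y j = bit m j" if "j < n" for j
      using that supported_on_nonzero[OF A, of x y j] supported_on_nonzero[OF B, of y z j]
        xz \<open>y < 2 ^ n\<close> disj by (cases "j \<in> S") (auto simp: m)
    then have "y = m" using that by (intro bits_eqI[of y n m]) (auto simp: m)
    then show False using that by simp
  qed
  then have "(\<Sum>y < 2 ^ n. A $$ (x, y) * B $$ (y, z)) = (\<Sum>y \<in> {m}. A $$ (x, y) * B $$ (y, z))"
    by (intro sum.mono_neutral_right) (auto simp: m)
  then show ?thesis
    using xz supported_on_carrier[OF A] supported_on_carrier[OF B]
    by (auto simp: scalar_prod_def atLeast0LessThan)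
qed

lemma supported_on_commute:
  assumes A: "supported_on n S A" and B: "supported_on n T B" and disj: "S \<inter> T = {}"
  shows "A * B = B * A"
proof (rule eq_matI)
  note c = supported_on_carrier[OF A] supported_on_carrier[OF B]
  fix x z assume "x < dim_row (B * A)" "z < dim_col (B * A)"
  then have xz: "x < 2 ^ n" "z < 2 ^ n" using c by auto
  define m where "m = of_bits n (\<lambda>j. if j \<in> S then bit z j else bit x j)"
  define m' where "m' = of_bits n (\<lambda>j. if j \<in> T then bit z j else bit x j)"
  have mn: "m < 2 ^ n" "m' < 2 ^ n" by (auto simp: m_def m'_def)
  have AB: "(A * B) $$ (x, z) = A $$ (x, m) * B $$ (m, z)"
    using supported_on_mult_index[OF A B disj xz m_def] .
  have BA: "(B * A) $$ (x, z) = B $$ (x, m') * A $$ (m', z)"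
    using supported_on_mult_index[OF B A _ xz m'_def] disj by blast
  show "(A * B) $$ (x, z) = (B * A) $$ (x, z)"
  \<comment> \<open>If x and z agree off both sets, the entries of the two products match pairwise;
    otherwise each product contains a zero factor.\<close>
  proof (cases "\<forall>j < n. j \<notin> S \<union> T \<longrightarrow> bit x j = bit z j")
    case True
    have "A $$ (x, m) = A $$ (m', z)"
      using True disj by (intro supported_on_cong[OF A xz(1) mn xz(2)]) (auto simp: m_def m'_def)
    moreover have "B $$ (m, z) = B $$ (x, m')"
      using True disj by (intro supported_on_cong[OF B mn(1) xz(2,1) mn(2)]) (auto simp: m_def m'_def)
    ultimately show ?thesis unfolding AB BA by simp
  next
    case False
    then obtain j where j: "j < n" "j \<notin> S" "j \<notin> T" "bit x j \<noteq> bit z j" by auto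
    then have "bit m j \<noteq> bit z j" "bit m' j \<noteq> bit z j" by (auto simp: m_def m'_def)
    then have "B $$ (m, z) = 0" "A $$ (m', z) = 0"
      using supported_on_nonzero[OF B _ mn(1) xz(2) j(1,3)]
        supported_on_nonzero[OF A _ mn(2) xz(2) j(1,2)] by blast+
    then show ?thesis unfolding AB BA by simp
  qed
qed (use supported_on_carrier[OF A] supported_on_carrier[OF B] in auto)

lemma gate_unitary_supported_on:
  assumes "gate_support g \<subseteq> {..<n}"
  shows "supported_on n (gate_support g) (gate_unitary n g)"
  unfolding supported_on_def
proof (intro conjI allI impI)
  fix x y x' y' :: nat
  assume lt: "x < 2 ^ n" "y < 2 ^ n" "x' < 2 ^ n" "y' < 2 ^ n"
    and eq: "\<forall>j < n. if j \<in> gate_support g then bit x j = bit x' j \<and> bit y j = bit y' j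
                 else bit x j = bit y j \<and> bit x' j = bit y' j"
  have "restrict_index (gate_qubits g) x = restrict_index (gate_qubits g) x'"
    "restrict_index (gate_qubits g) y = restrict_index (gate_qubits g) y'"
    using assms eq by (auto simp: restrict_index_eq_iff subset_iff)
  then show "gate_unitary n g $$ (x, y) = gate_unitary n g $$ (x', y')"
    using lt eq unfolding gate_unitary_def by auto
qed (auto simp: gate_unitary_def split: if_splits)

section \<open>Pauli Z on a single qubit\<close>

definition pauli_Z_on :: "nat \<Rightarrow> nat \<Rightarrow> complex mat" where
  "pauli_Z_on n q = mat (2 ^ n) (2 ^ n) (\<lambda>(x, y). if x = y then if bit x q then - 1 else 1 else 0)"

lemma pauli_Z_on_carrier [simp]: "pauli_Z_on n q \<in> carrier_mat (2 ^ n) (2 ^ n)"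
  unfolding pauli_Z_on_def by auto

lemma pauli_Z_on_dim [simp]:
  "dim_row (pauli_Z_on n q) = 2 ^ n" "dim_col (pauli_Z_on n q) = 2 ^ n"
  unfolding pauli_Z_on_def by auto

lemma pauli_Z_on_supported_on:
  assumes "q < n"
  shows "supported_on n {q} (pauli_Z_on n q)"
  unfolding supported_on_def
proof (intro conjI allI impI)
  fix x y x' y' :: nat
  assume lt: "x < 2 ^ n" "y < 2 ^ n" "x' < 2 ^ n" "y' < 2 ^ n"
    and eq: "\<forall>j < n. if j \<in> {q} then bit x j = bit x' j \<and> bit y j = bit y' j
                 else bit x j = bit y j \<and> bit x' j = bit y' j"
  have "x = y \<longleftrightarrow> bit x q = bit y q" "x' = y' \<longleftrightarrow> bit x' q = bit y' q"
    using eq bits_eqI[OF lt(1,2)] bits_eqI[OF lt(3,4)] by (auto split: if_splits)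
  moreover have "bit x q = bit x' q \<and> bit y q = bit y' q"
    using eq assms by auto
  ultimately show "pauli_Z_on n q $$ (x, y) = pauli_Z_on n q $$ (x', y')"
    using lt unfolding pauli_Z_on_def by auto
qed (auto simp: pauli_Z_on_def split: if_splits)

lemma mult_pauli_Z_on_index:
  assumes "A \<in> carrier_mat (2 ^ n) (2 ^ n)" "x < 2 ^ n" "y < 2 ^ n"
  shows "(A * pauli_Z_on n q) $$ (x, y) = A $$ (x, y) * (if bit y q then - 1 else 1)"
proof -
  have "(A * pauli_Z_on n q) $$ (x, y)
      = (\<Sum>u < 2 ^ n. A $$ (x, u) * (if u = y then if bit u q then - 1 else 1 else 0))"
    using assms by (auto simp: pauli_Z_on_def scalar_prod_def atLeast0LessThan intro!: sum.cong)
  also have "\<dots> = (\<Sum>u < 2 ^ n. if u = y then A $$ (x, u) * (if bit u q then - 1 else 1) else 0)"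
    by (intro sum.cong) auto
  finally show ?thesis using assms by simp
qed

lemma pauli_Z_on_mult_index:
  assumes "A \<in> carrier_mat (2 ^ n) (2 ^ n)" "x < 2 ^ n" "y < 2 ^ n"
  shows "(pauli_Z_on n q * A) $$ (x, y) = (if bit x q then - 1 else 1) * A $$ (x, y)"
proof -
  have "(pauli_Z_on n q * A) $$ (x, y)
      = (\<Sum>u < 2 ^ n. (if x = u then if bit x q then - 1 else 1 else 0) * A $$ (u, y))"
    using assms by (auto simp: pauli_Z_on_def scalar_prod_def atLeast0LessThan intro!: sum.cong)
  also have "\<dots> = (\<Sum>u < 2 ^ n. if u = x then (if bit x q then - 1 else 1) * A $$ (u, y) else 0)"
    by (intro sum.cong) auto
  finally show ?thesis using assms by simp
qed

text \<open>\<open>Y_power n\<close> flips every bit, in particular bit q, which reverses the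
  eigenvalue of Z_q.\<close>

lemma Y_power_anticommutes_pauli_Z_on:
  assumes "q < n"
  shows "Y_power n * pauli_Z_on n q = - (pauli_Z_on n q * Y_power n)"
  using assms
  by (intro eq_matI)
     (auto simp: mult_pauli_Z_on_index pauli_Z_on_mult_index Y_power_index_complement
       simp del: index_mult_mat(1))

subsection \<open>Lightcones\<close>

definition layer_reach :: "layer \<Rightarrow> nat set \<Rightarrow> nat set" where
  "layer_reach L S = S \<union> (\<Union>g \<in> {g \<in> set L. gate_support g \<inter> S \<noteq> {}}. gate_support g)"

lemma lightcone_eq_fold: "lightcone C q = fold layer_reach C {q}"
  unfolding lightcone_def layer_reach_def[abs_def] ..

lemma layer_reach_UN: "layer_reach L S = (\<Union>x \<in> S. layer_reach L {x})"
  unfolding layer_reach_def by auto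

lemma fold_layer_reach_UN: "fold layer_reach C S = (\<Union>x \<in> S. fold layer_reach C {x})"
proof (induction C arbitrary: S)
  case (Cons L C)
  have "fold layer_reach (L # C) S = (\<Union>y \<in> layer_reach L S. fold layer_reach C {y})"
    using Cons[of "layer_reach L S"] by simp
  also have "\<dots> = (\<Union>x \<in> S. \<Union>y \<in> layer_reach L {x}. fold layer_reach C {y})"
    by (subst layer_reach_UN) blast
  also have "\<dots> = (\<Union>x \<in> S. fold layer_reach (L # C) {x})"
    using Cons[of "layer_reach L {x}" for x] by auto
  finally show ?case .
qed simp

lemma mem_layer_reach_sym: "y \<in> layer_reach L {x} \<longleftrightarrow> x \<in> layer_reach L {y}"
  unfolding layer_reach_def by auto

text \<open>Reaching a qubit within one layer is a symmetric relation, so a chain through the layers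
  read backwards is a chain through the reversed circuit.\<close>

lemma mem_lightcone_rev: "p \<in> lightcone C q \<longleftrightarrow> q \<in> lightcone (rev C) p"
  unfolding lightcone_eq_fold
proof (induction C arbitrary: q)
  case (Cons L C)
  have "p \<in> fold layer_reach (L # C) {q} \<longleftrightarrow> (\<exists>x \<in> layer_reach L {q}. p \<in> fold layer_reach C {x})"
    using fold_layer_reach_UN[of C "layer_reach L {q}"] by auto
  also have "\<dots> \<longleftrightarrow> (\<exists>x \<in> fold layer_reach (rev C) {p}. q \<in> layer_reach L {x})"
    using Cons mem_layer_reach_sym by blast
  also have "\<dots> \<longleftrightarrow> q \<in> fold layer_reach (rev (L # C)) {p}"
    using layer_reach_UN[of L "fold layer_reach (rev C) {p}"] by auto
  finally show ?case .
qed auto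

lemma mem_backward_lightcone: "p \<in> backward_lightcone C q \<longleftrightarrow> q \<in> lightcone C p"
  unfolding backward_lightcone_def using mem_lightcone_rev by blast

text \<open>The support that a gate adds does not meet the other gates of its layer. Hence
  processing the gates one by one reaches the same set as the whole layer at once.\<close>

lemma layer_reach_Cons:
  assumes "\<forall>h \<in> set L. gate_support g \<inter> gate_support h = {}"
  shows "layer_reach (g # L) S
       = layer_reach L (if gate_support g \<inter> S = {} then S else S \<union> gate_support g)"
  using assms unfolding layer_reach_def by (auto 0 3)

lemma layer_reach_cong_layout:
  assumes "gate_support ` set L = gate_support ` set L'"
  shows "layer_reach L = layer_reach L'"
proof
  fix S
  have "layer_reach M S = S \<union> \<Union> {T \<in> gate_support ` set M. T \<inter> S \<noteq> {}}" for M
    unfolding layer_reach_def by auto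
  then show "layer_reach L S = layer_reach L' S" using assms by simp
qed

lemma lightcone_cong_layout:
  assumes "layout C = layout C'"
  shows "lightcone C q = lightcone C' q"
proof -
  have "fold layer_reach C S = fold layer_reach C' S" for S
    using assms
  proof (induction C arbitrary: C' S)
    case (Cons L C)
    then obtain L' D where "C' = L' # D" "gate_support ` set L = gate_support ` set L'" "layout C = layout D"
      unfolding layout_def by (cases C') auto
    with Cons.IH[of D] layer_reach_cong_layout[of L L'] show ?case by simp
  qed (auto simp: layout_def)
  then show ?thesis unfolding lightcone_eq_fold .
qed

subsection \<open>Heisenberg evolution stays in the lightcone\<close>

text \<open>A commutant version of being supported on S. Its behaviour under conjugation by a gate
  follows from commutation alone, with no computation of matrix entries.\<close>

definition commutes_outside :: "nat \<Rightarrow> nat set \<Rightarrow> complex mat \<Rightarrow> bool" where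
  "commutes_outside n S W \<longleftrightarrow> W \<in> carrier_mat (2 ^ n) (2 ^ n) \<and>
     (\<forall>R B. supported_on n R B \<longrightarrow> R \<inter> S = {} \<longrightarrow> W * B = B * W)"

lemma commutes_outside_carrier: "commutes_outside n S W \<Longrightarrow> W \<in> carrier_mat (2 ^ n) (2 ^ n)"
  unfolding commutes_outside_def by auto

lemma commutes_outsideD:
  "commutes_outside n S W \<Longrightarrow> supported_on n R B \<Longrightarrow> R \<inter> S = {} \<Longrightarrow> W * B = B * W"
  unfolding commutes_outside_def by blast

lemma supported_on_commutes_outside: "supported_on n S W \<Longrightarrow> commutes_outside n S W"
  unfolding commutes_outside_def using supported_on_commute supported_on_carrier by blast

text \<open>A gate that misses S commutes with W, and W' = W works. Otherwise W' = V W V^-1 commutes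
  with every operator supported off S and off the gate, because both V and W do.\<close>

lemma gate_evolution:
  assumes g: "local_symplectic_gate n G k g" and W: "commutes_outside n S W"
  shows "\<exists>W'. commutes_outside n (if gate_support g \<inter> S = {} then S else S \<union> gate_support g) W' \<and>
           W' * gate_unitary n g = gate_unitary n g * W"
proof -
  let ?N = "2 ^ n :: nat"
  define V where "V = gate_unitary n g"
  have supp: "supported_on n (gate_support g) V"
    using g gate_unitary_supported_on unfolding local_symplectic_gate_def V_def by auto
  show ?thesis
  proof (cases "gate_support g \<inter> S = {}")
    case True
    then show ?thesis using commutes_outsideD[OF W supp] W unfolding V_def by auto
  next
    case False
    have V: "V * mat_adjoint V = 1\<^sub>m ?N" "mat_adjoint V * V = 1\<^sub>m ?N"
      using gate_unitary_symplectic[OF g]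
      unfolding V_def symplectic_group_def unitary_group_def by auto
    have Vc: "V \<in> carrier_mat ?N ?N" by (simp add: V_def)
    note c = Vc mat_adjoint_carrier[OF Vc] commutes_outside_carrier[OF W]
    note assoc = assoc_mult_mat[of _ ?N ?N _ ?N _ ?N] mult_carrier_mat[of _ ?N ?N _ ?N]
    define W' where "W' = V * W * mat_adjoint V"
    have W'c: "W' \<in> carrier_mat ?N ?N" unfolding W'_def using c by auto
    have "commutes_outside n (S \<union> gate_support g) W'"
      unfolding commutes_outside_def
    proof (intro conjI allI impI W'c)
      fix R B assume B: "supported_on n R B" and R: "R \<inter> (S \<union> gate_support g) = {}"
      have Bc: "B \<in> carrier_mat ?N ?N" using supported_on_carrier[OF B] .
      have WB: "W * B = B * W" using commutes_outsideD[OF W B] R by auto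
      have VB: "V * B = B * V" using supported_on_commute[OF supp B] R by auto
      have "mat_adjoint V * B = mat_adjoint V * (B * (V * mat_adjoint V))"
        using Bc by (simp add: V(1))
      also have "\<dots> = mat_adjoint V * (V * B) * mat_adjoint V"
        unfolding VB using c Bc by (simp add: assoc)
      also have "\<dots> = (mat_adjoint V * V) * B * mat_adjoint V"
        using c Bc by (simp add: assoc)
      also have "\<dots> = B * mat_adjoint V"
        using Bc by (simp add: V(2))
      finally have "W' * B = V * W * (B * mat_adjoint V)"
        unfolding W'_def using c Bc by (simp add: assoc)
      also have "\<dots> = V * (W * B) * mat_adjoint V" using c Bc by (simp add: assoc)
      also have "\<dots> = (V * B) * (W * mat_adjoint V)" unfolding WB using c Bc by (simp add: assoc)
      also have "\<dots> = B * W'" unfolding VB W'_def using c Bc by (simp add: assoc)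
      finally show "W' * B = B * W'" .
    qed
    moreover have "W' * V = V * W * (mat_adjoint V * V)"
      unfolding W'_def using c by (simp add: assoc)
    then have "W' * V = V * W" using c by (simp add: V(2))
    ultimately show ?thesis using False unfolding V_def by auto
  qed
qed

text \<open>U stands for what has already been applied and \<open>W\<^sub>0\<close> for the initial
  operator. The intertwining relation \<open>W * U = U * W\<^sub>0\<close> is the invariant that
  carries the induction through the accumulator of \<open>fold\<close>.\<close>

lemma layer_evolution:
  assumes "\<forall>g \<in> set L. local_symplectic_gate n G k g"
    and "sorted_wrt (\<lambda>g h. gate_support g \<inter> gate_support h = {}) L"
    and "commutes_outside n S W" "U \<in> carrier_mat (2 ^ n) (2 ^ n)"
      "W\<^sub>0 \<in> carrier_mat (2 ^ n) (2 ^ n)" "W * U = U * W\<^sub>0"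
  shows "\<exists>W'. commutes_outside n (layer_reach L S) W' \<and>
           W' * fold (\<lambda>g U. gate_unitary n g * U) L U = fold (\<lambda>g U. gate_unitary n g * U) L U * W\<^sub>0"
  using assms
proof (induction L arbitrary: S W U)
  case Nil
  then show ?case by (auto simp: layer_reach_def)
next
  case (Cons g L)
  let ?N = "2 ^ n :: nat"
  note assoc = assoc_mult_mat[of _ ?N ?N _ ?N _ ?N]
  define S' where "S' = (if gate_support g \<inter> S = {} then S else S \<union> gate_support g)"
  obtain W' where W': "commutes_outside n S' W'" "W' * gate_unitary n g = gate_unitary n g * W"
    using gate_evolution[of n G k g S W] Cons.prems unfolding S'_def by auto
  note c = gate_unitary_carrier[of n g] commutes_outside_carrier[OF W'(1)]
    commutes_outside_carrier[OF Cons.prems(3)] Cons.prems(4,5)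
  have "W' * (gate_unitary n g * U) = W' * gate_unitary n g * U"
    using c by (simp add: assoc)
  also have "\<dots> = gate_unitary n g * (W * U)"
    unfolding W'(2) using c by (simp add: assoc)
  also have "\<dots> = gate_unitary n g * U * W\<^sub>0"
    unfolding Cons.prems(6) using c by (simp add: assoc)
  finally have "W' * (gate_unitary n g * U) = gate_unitary n g * U * W\<^sub>0" .
  moreover have "gate_unitary n g * U \<in> carrier_mat ?N ?N" using c by auto
  moreover have "layer_reach (g # L) S = layer_reach L S'"
    using Cons.prems(2) unfolding S'_def by (intro layer_reach_Cons) auto
  ultimately show ?case
    using Cons.IH[OF _ _ W'(1)] Cons.prems by auto
qed

lemma circuit_evolution:
  assumes "local_symplectic_circuit n G k C" "commutes_outside n S W" "W \<in> carrier_mat (2 ^ n) (2 ^ n)"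
  shows "\<exists>W'. commutes_outside n (fold layer_reach C S) W' \<and>
           W' * circuit_unitary n C = circuit_unitary n C * W"
proof -
  let ?N = "2 ^ n :: nat"
  note assoc = assoc_mult_mat[of _ ?N ?N _ ?N _ ?N]
  \<comment> \<open>Generalised over the accumulated unitary U and the current operator W', with the
    initial W fixed.\<close>
  have "\<exists>W''. commutes_outside n (fold layer_reach C S) W'' \<and>
           W'' * fold (\<lambda>L U. layer_unitary n L * U) C U = fold (\<lambda>L U. layer_unitary n L * U) C U * W"
    if "local_symplectic_circuit n G k C" "commutes_outside n S W'" "U \<in> carrier_mat ?N ?N" "W' * U = U * W"
    for S W' U
    using that
  proof (induction C arbitrary: S W' U)
    case (Cons L C)
    have L: "\<forall>g \<in> set L. local_symplectic_gate n G k g"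
      "sorted_wrt (\<lambda>g h. gate_support g \<inter> gate_support h = {}) L"
      and C: "local_symplectic_circuit n G k C"
      using Cons.prems(1) unfolding local_symplectic_circuit_def by auto
    have W'c: "W' \<in> carrier_mat ?N ?N" using commutes_outside_carrier Cons.prems(2) .
    obtain W'' where W'': "commutes_outside n (layer_reach L S) W''"
      "W'' * layer_unitary n L = layer_unitary n L * W'"
      using layer_evolution[OF L Cons.prems(2) one_carrier_mat W'c] W'c
      unfolding layer_unitary_def by auto
    note c = symplectic_group_carrier[OF layer_unitary_symplectic[OF L(1)]]
      commutes_outside_carrier[OF W''(1)] W'c Cons.prems(3) assms(3)
    have "W'' * (layer_unitary n L * U) = W'' * layer_unitary n L * U"
      using c by (simp add: assoc)
    also have "\<dots> = layer_unitary n L * (W' * U)"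
      unfolding W''(2) using c by (simp add: assoc)
    also have "\<dots> = layer_unitary n L * U * W"
      unfolding Cons.prems(4) using c by (simp add: assoc)
    finally have "W'' * (layer_unitary n L * U) = layer_unitary n L * U * W" .
    moreover have "layer_unitary n L * U \<in> carrier_mat ?N ?N" using c by auto
    ultimately show ?case using Cons.IH[OF C W''(1)] by auto
  qed auto
  from this[OF assms(1,2) one_carrier_mat] assms(3) show ?thesis
    unfolding circuit_unitary_def by auto
qed

text \<open>
  For odd \<open>n\<close> the matrix \<open>Y\<^sup>\<otimes>\<^sup>n Z\<^sub>q\<close> is symmetric, so that its quadratic form in \<open>\<psi> = U|0\<rangle>\<close> is a
  nontrivial linear functional of \<open>\<psi> \<otimes> \<psi>\<close>.
\<close>

definition test_form :: "nat \<Rightarrow> nat \<Rightarrow> complex mat \<Rightarrow> complex" where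
  "test_form n q U = (transpose_mat U * (Y_power n * pauli_Z_on n q) * U) $$ (0, 0)"

text \<open>In matrix form, F = U^T Y Z_q U anticommutes with Z_p: since U^T Y = Y U^-1, moving Z_p
  from the right end to the left end passes U, Z_q and U^-1 without a sign and Y with one.\<close>

lemma test_form_eq_0:
  assumes C: "local_symplectic_circuit n G k C" and pq: "p < n" "q < n"
    and cone: "q \<notin> lightcone C p"
  shows "test_form n q (circuit_unitary n C) = 0"
proof -
  let ?N = "2 ^ n :: nat"
  note assoc = assoc_mult_mat[of _ ?N ?N _ ?N _ ?N] mult_carrier_mat[of _ ?N ?N _ ?N]
  define U where "U = circuit_unitary n C"
  define Zp where "Zp = pauli_Z_on n p"
  define Zq where "Zq = pauli_Z_on n q"
  define Y where "Y = Y_power n"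
  define T where "T = transpose_mat U"
  define A where "A = mat_adjoint U"
  have sU: "U \<in> symplectic_group n"
    unfolding U_def using circuit_unitary_symplectic[OF C] .
  have A: "U * A = 1\<^sub>m ?N" "A * U = 1\<^sub>m ?N"
    using sU unfolding A_def symplectic_group_def unitary_group_def by auto
  have TY: "T * Y = Y * A"
    using symplectic_group_transpose_Y[OF sU] unfolding T_def Y_def A_def .
  have YZ: "Y * Zp = - (Zp * Y)"
    unfolding Y_def Zp_def using Y_power_anticommutes_pauli_Z_on[OF pq(1)] .
  obtain W where W: "commutes_outside n (lightcone C p) W" "W * U = U * Zp"
    using circuit_evolution[OF C, of "{p}" Zp] supported_on_commutes_outside pauli_Z_on_supported_on pq
    unfolding U_def Zp_def lightcone_eq_fold by auto
  have WZ: "W * Zq = Zq * W"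
    using commutes_outsideD[OF W(1) pauli_Z_on_supported_on[OF pq(2)]] cone unfolding Zq_def by auto
  have c: "U \<in> carrier_mat ?N ?N" "Zp \<in> carrier_mat ?N ?N" "Zq \<in> carrier_mat ?N ?N"
    "Y \<in> carrier_mat ?N ?N" "T \<in> carrier_mat ?N ?N" "A \<in> carrier_mat ?N ?N" "W \<in> carrier_mat ?N ?N"
    using symplectic_group_carrier[OF sU] commutes_outside_carrier[OF W(1)]
    by (auto simp: Zp_def Zq_def Y_def T_def A_def)
  \<comment> \<open>The relation W U = U Z_p is multiplied by U^-1 from both sides.\<close>
  have "A * W = A * (W * (U * A))" using c by (simp add: A)
  also have "\<dots> = A * (W * U) * A" using c by (simp add: assoc)
  also have "\<dots> = (A * U) * Zp * A" unfolding W(2) using c by (simp add: assoc)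
  also have "\<dots> = Zp * A" using c by (simp add: A)
  finally have AW: "A * W = Zp * A" .
  have "T * Y * W = Y * (A * W)" unfolding TY using c by (simp add: assoc)
  also have "\<dots> = Y * Zp * A" unfolding AW using c by (simp add: assoc)
  also have "\<dots> = - (Zp * Y * A)" unfolding YZ using c by simp
  also have "\<dots> = - (Zp * (T * Y))" unfolding TY using c by (simp add: assoc)
  finally have TYW: "T * Y * W = - (Zp * (T * Y))" .
  define F where "F = T * (Y * Zq) * U"
  have Fc: "F \<in> carrier_mat ?N ?N" unfolding F_def using c by auto
  have "F * Zp = T * Y * (Zq * (U * Zp))" unfolding F_def using c by (simp add: assoc)
  also have "\<dots> = T * Y * ((Zq * W) * U)" unfolding W(2)[symmetric] using c by (simp add: assoc)
  also have "\<dots> = (T * Y * W) * (Zq * U)" unfolding WZ[symmetric] using c by (simp add: assoc)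
  also have "\<dots> = - (Zp * (T * Y) * (Zq * U))" unfolding TYW using c by simp
  also have "\<dots> = - (Zp * F)" unfolding F_def using c by (simp add: assoc)
  finally have eq: "F * Zp = - (Zp * F)" .
  \<comment> \<open>Bit p of the index 0 is clear, so Z_p multiplies the entry at (0, 0) by 1 from
    either side, and the entry equals its negative.\<close>
  have "F $$ (0, 0) = (F * Zp) $$ (0, 0)"
    unfolding Zp_def using Fc by (subst mult_pauli_Z_on_index) auto
  also have "\<dots> = - ((Zp * F) $$ (0, 0))"
    unfolding eq using Fc c by (subst index_uminus_mat) auto
  also have "\<dots> = - F $$ (0, 0)"
    unfolding Zp_def using Fc by (subst pauli_Z_on_mult_index) auto
  finally show ?thesis
    unfolding test_form_def F_def T_def Y_def Zq_def U_def by simp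
qed

subsection \<open>Growth of lightcones\<close>

text \<open>Disjointness allows at most one gate at x, which adds at most k qubits to x itself. The
  slack from k + 1 to k + 2 keeps the base of the growth bound at least 2, so that its logarithm is
  positive also for k = 0.\<close>

lemma card_layer_reach_singleton:
  assumes "\<forall>g \<in> set L. local_symplectic_gate n G k g"
    and "sorted_wrt (\<lambda>g h. gate_support g \<inter> gate_support h = {}) L"
  shows "finite (layer_reach L {x})" "card (layer_reach L {x}) \<le> k + 2"
proof -
  have disj: "gate_support g \<inter> gate_support h = {}" if "g \<in> set L" "h \<in> set L" "g \<noteq> h" for g h
    using assms(2) that by (induction L) auto
  show "finite (layer_reach L {x})" unfolding layer_reach_def by auto
  show "card (layer_reach L {x}) \<le> k + 2"
  proof (cases "\<exists>g \<in> set L. x \<in> gate_support g")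
    case True
    then obtain g where g: "g \<in> set L" "x \<in> gate_support g" by auto
    then have "layer_reach L {x} \<subseteq> insert x (gate_support g)"
      unfolding layer_reach_def using disj by blast
    then have "card (layer_reach L {x}) \<le> card (insert x (gate_support g))"
      by (intro card_mono) auto
    also have "\<dots> \<le> Suc (card (gate_support g))" by (rule card_insert_le_m1) auto
    also have "card (gate_support g) \<le> k"
      using assms(1) g card_length[of "gate_qubits g"]
      unfolding local_symplectic_gate_def by (auto simp: Let_def intro: order_trans)
    finally show ?thesis by simp
  next
    case False
    then have "layer_reach L {x} = {x}" unfolding layer_reach_def by auto
    then show ?thesis by simp
  qed
qed

lemma card_lightcone_le:
  assumes "local_symplectic_circuit n G k C"
  shows "finite (lightcone C q)" "card (lightcone C q) \<le> (k + 2) ^ length C"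
proof -
  have "finite (fold layer_reach C S) \<and> card (fold layer_reach C S) \<le> (k + 2) ^ length C * card S"
    if "finite S" "local_symplectic_circuit n G k C" for S
    using that
  proof (induction C arbitrary: S)
    case (Cons L C)
    have L: "\<forall>g \<in> set L. local_symplectic_gate n G k g"
      "sorted_wrt (\<lambda>g h. gate_support g \<inter> gate_support h = {}) L"
      and C: "local_symplectic_circuit n G k C"
      using Cons.prems(2) unfolding local_symplectic_circuit_def by auto
    have fin: "finite (layer_reach L S)"
      by (subst layer_reach_UN) (use Cons.prems card_layer_reach_singleton[OF L] in auto)
    have "card (layer_reach L S) \<le> (\<Sum>x \<in> S. card (layer_reach L {x}))"
      by (subst layer_reach_UN) (rule card_UN_le[OF Cons.prems(1)])
    also have "\<dots> \<le> card S * (k + 2)"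
      using sum_bounded_above[of S "\<lambda>x. card (layer_reach L {x})" "k + 2"]
        card_layer_reach_singleton[OF L] by simp
    finally have "card (layer_reach L S) \<le> card S * (k + 2)" .
    then have "(k + 2) ^ length C * card (layer_reach L S) \<le> (k + 2) ^ length C * (card S * (k + 2))"
      by (rule mult_left_mono) simp
    also have "\<dots> = (k + 2) ^ length (L # C) * card S" by (simp add: algebra_simps)
    finally show ?case using Cons.IH[OF fin C] by (auto intro: order_trans)
  qed auto
  from this[of "{q}"] assms show "finite (lightcone C q)" "card (lightcone C q) \<le> (k + 2) ^ length C"
    unfolding lightcone_eq_fold by auto
qed

section \<open>Displacement on the ring and linear growth of lightcones\<close>

definition ring_near :: "nat \<Rightarrow> nat \<Rightarrow> nat \<Rightarrow> nat \<Rightarrow> bool" where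
  "ring_near n m x y \<longleftrightarrow> (\<exists>t. \<bar>t\<bar> \<le> int m \<and> int y = (int x + t) mod int n)"

lemma ring_near_refl: "x < n \<Longrightarrow> ring_near n m x x"
  unfolding ring_near_def by (intro exI[of _ 0]) auto

text \<open>With signed displacements modulo n, the triangle inequality is the addition of
  displacements, also across the boundary of the ring.\<close>

lemma ring_near_trans:
  assumes "ring_near n a x y" "ring_near n b y z"
  shows "ring_near n (a + b) x z"
proof -
  obtain s t where "\<bar>s\<bar> \<le> int a" "int y = (int x + s) mod int n"
    "\<bar>t\<bar> \<le> int b" "int z = (int y + t) mod int n"
    using assms unfolding ring_near_def by auto
  then show ?thesis
    unfolding ring_near_def by (intro exI[of _ "s + t"]) (auto simp: mod_simps add.assoc)
qed

lemma ring_near_mono: "ring_near n a x y \<Longrightarrow> a \<le> b \<Longrightarrow> ring_near n b x y"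
  unfolding ring_near_def
  by (meson of_nat_mono order_trans)

lemma ring_graph_near:
  assumes "(x, y) \<in> ring_graph n"
  shows "ring_near n 1 x y"
proof -
  from assms have lt: "x < n" "y < n" and "y = Suc x mod n \<or> x = Suc y mod n"
    unfolding ring_graph_def by auto
  then consider "int y = (int x + 1) mod int n" | "int x = (int y + 1) mod int n"
    by (metis zmod_int int_Suc)
  then show ?thesis
  proof cases
    case 1
    then show ?thesis unfolding ring_near_def by (intro exI[of _ 1]) auto
  next
    case 2
    then have "(int x + - 1) mod int n = (int y + 1 - 1) mod int n"
      using mod_diff_left_eq[of "int y + 1" "int n" 1] by simp
    then show ?thesis using lt unfolding ring_near_def by (intro exI[of _ "- 1"]) auto
  qed
qed

lemma relpow_ring_near:
  assumes "R \<subseteq> ring_graph n" "x < n" "(x, y) \<in> R ^^ m"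
  shows "ring_near n m x y"
  using assms(3)
proof (induction m arbitrary: y)
  case 0
  then show ?case using ring_near_refl assms by auto
next
  case (Suc m)
  then obtain z where "(x, z) \<in> R ^^ m" "(z, y) \<in> R" by auto
  with Suc.IH assms(1) ring_graph_near ring_near_trans[of n m x z 1 y] show ?case by auto
qed

text \<open>A connected support of at most k qubits has at most k * k directed edges, and some path
  between two of its qubits has no more steps than there are edges.\<close>

lemma layer_reach_ring_near:
  assumes L: "\<forall>g \<in> set L. local_symplectic_gate n G k g" and G: "G \<subseteq> ring_graph n"
    and "x < n" "y \<in> layer_reach L {x}"
  shows "ring_near n (k * k) x y"
proof (cases "y = x")
  case True
  then show ?thesis using ring_near_refl assms by auto
next
  case False
  then obtain g where g: "g \<in> set L" "x \<in> gate_support g" "y \<in> gate_support g"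
    using assms(4) unfolding layer_reach_def by auto
  let ?S = "gate_support g"
  have lc: "connected_in G ?S" and "length (gate_qubits g) \<le> k"
    using L g unfolding local_symplectic_gate_def by (auto simp: Let_def)
  then have "card ?S \<le> k" using card_length[of "gate_qubits g"] by linarith
  then have "card (G \<inter> ?S \<times> ?S) \<le> k * k"
    using card_mono[of "?S \<times> ?S" "G \<inter> ?S \<times> ?S"] mult_mono[of "card ?S" k "card ?S" k]
    by (auto simp: card_cartesian_product)
  moreover have "finite (G \<inter> ?S \<times> ?S)" by auto
  then obtain m where "m \<le> card (G \<inter> ?S \<times> ?S)" "(x, y) \<in> (G \<inter> ?S \<times> ?S) ^^ m"
    using lc g unfolding connected_in_def by (auto simp: rtrancl_finite_eq_relpow)
  ultimately show ?thesis
    using relpow_ring_near[of "G \<inter> ?S \<times> ?S" n x y m] G assms(3)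
      ring_near_mono[of n m x y "k * k"] by auto
qed

lemma lightcone_ring_near:
  assumes "local_symplectic_circuit n G k C" "G \<subseteq> ring_graph n" "q < n" "y \<in> lightcone C q"
  shows "ring_near n (length C * (k * k)) q y"
  using assms unfolding lightcone_eq_fold
proof (induction C arbitrary: q)
  case Nil
  then show ?case using ring_near_refl by auto
next
  case (Cons L C)
  have L: "\<forall>g \<in> set L. local_symplectic_gate n G k g" and C: "local_symplectic_circuit n G k C"
    using Cons.prems(1) unfolding local_symplectic_circuit_def by auto
  obtain z where z: "z \<in> layer_reach L {q}" "y \<in> fold layer_reach C {z}"
    using Cons.prems(4) fold_layer_reach_UN[of C "layer_reach L {q}"] by auto
  have "z < n"
    using z(1) Cons.prems(3) L unfolding layer_reach_def local_symplectic_gate_def by auto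
  from ring_near_trans[OF layer_reach_ring_near[OF L Cons.prems(2,3) z(1)]
      Cons.IH[OF C Cons.prems(2) this z(2)]]
  show ?case by (simp add: algebra_simps)
qed

text \<open>There are 2 * m + 1 admissible displacements, and each determines y.\<close>

lemma ring_near_card:
  shows "finite {y. ring_near n m x y}" "card {y. ring_near n m x y} \<le> 2 * m + 1"
proof -
  have sub: "{y. ring_near n m x y} \<subseteq> (\<lambda>t. nat ((int x + t) mod int n)) ` {- int m..int m}"
  proof
    fix y assume "y \<in> {y. ring_near n m x y}"
    then obtain t where t: "\<bar>t\<bar> \<le> int m" "int y = (int x + t) mod int n"
      unfolding ring_near_def by auto
    then have "y = nat ((int x + t) mod int n)" by (metis nat_int)
    then show "y \<in> (\<lambda>t. nat ((int x + t) mod int n)) ` {- int m..int m}"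
      using t(1) by (intro image_eqI[of _ _ t]) auto
  qed
  then show "finite {y. ring_near n m x y}" by (rule finite_subset) simp
  have "card {y. ring_near n m x y} \<le> card {- int m..int m}"
    using sub by (rule surj_card_le[rotated]) simp
  then show "card {y. ring_near n m x y} \<le> 2 * m + 1" by simp
qed

lemma line_graph_subset_ring_graph: "line_graph n \<subseteq> ring_graph n"
  unfolding line_graph_def ring_graph_def by auto

subsection \<open>Haar-random states are not annihilated by the test form\<close>

definition test_matrix :: "nat \<Rightarrow> nat \<Rightarrow> complex mat" where
  "test_matrix n q = Y_power n * pauli_Z_on n q"

text \<open>The only nonzero entry in row x of \<open>test_matrix n q\<close>. The sign of Z_q is
  read at the column, hence at the complement of x.\<close>

definition test_weight :: "nat \<Rightarrow> nat \<Rightarrow> nat \<Rightarrow> complex" where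
  "test_weight n q x = Y_sign n x * (if bit (complement_index n x) q then - 1 else 1)"

lemma test_matrix_index:
  assumes "x < 2 ^ n" "y < 2 ^ n"
  shows "test_matrix n q $$ (x, y) = (if y = complement_index n x then test_weight n q x else 0)"
  using assms unfolding test_matrix_def
  by (subst mult_pauli_Z_on_index) (auto simp: Y_power_index_complement test_weight_def)

lemma test_form_double_sum:
  assumes "U \<in> carrier_mat (2 ^ n) (2 ^ n)"
  shows "test_form n q U
       = (\<Sum>x < 2 ^ n. \<Sum>y < 2 ^ n. U $$ (x, 0) * U $$ (y, 0) * test_matrix n q $$ (x, y))"
proof -
  have M: "test_matrix n q \<in> carrier_mat (2 ^ n) (2 ^ n)" unfolding test_matrix_def by auto
  have "test_form n q U
      = (transpose_mat U * test_matrix n q * transpose_mat (transpose_mat U)) $$ (0, 0)"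
    unfolding test_form_def test_matrix_def by simp
  also have "\<dots> = (\<Sum>x < 2 ^ n. transpose_mat U $$ (0, x) *
      (\<Sum>y < 2 ^ n. transpose_mat U $$ (0, y) * test_matrix n q $$ (x, y)))"
    using assms M by (intro mat_sandwich_transpose_index) auto
  also have "\<dots> = (\<Sum>x < 2 ^ n. \<Sum>y < 2 ^ n. U $$ (x, 0) * U $$ (y, 0) * test_matrix n q $$ (x, y))"
    using assms by (auto simp: sum_distrib_left mult_ac intro!: sum.cong)
  finally show ?thesis .
qed

lemma test_form_sum:
  assumes "U \<in> carrier_mat (2 ^ n) (2 ^ n)"
  shows "test_form n q U
       = (\<Sum>x < 2 ^ n. test_weight n q x * U $$ (x, 0) * U $$ (complement_index n x, 0))"
proof -
  have "(\<Sum>y < 2 ^ n. U $$ (x, 0) * U $$ (y, 0) * test_matrix n q $$ (x, y))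
      = test_weight n q x * U $$ (x, 0) * U $$ (complement_index n x, 0)" if "x < 2 ^ n" for x
  proof -
    have "(\<Sum>y < 2 ^ n. U $$ (x, 0) * U $$ (y, 0) * test_matrix n q $$ (x, y))
      = (\<Sum>y < 2 ^ n. if y = complement_index n x
           then test_weight n q x * U $$ (x, 0) * U $$ (y, 0) else 0)"
      using that by (intro sum.cong) (auto simp: test_matrix_index)
    then show ?thesis by simp
  qed
  then show ?thesis unfolding test_form_double_sum[OF assms] by (intro sum.cong) auto
qed

text \<open>Passing to the complement gives (-1)^n = -1 from Y and another -1 from the flipped bit
  q. This is the symmetry of \<open>test_matrix n q\<close>.\<close>

lemma test_weight_complement:
  assumes "odd n" "q < n" "x < 2 ^ n"
  shows "test_weight n q (complement_index n x) = test_weight n q x"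
  using assms unfolding test_weight_def by (auto simp: Y_sign_complement)

lemma test_weight_nonzero: "test_weight n q x \<noteq> 0"
  unfolding test_weight_def by auto

section \<open>Rotations in the plane of a basis state and its complement\<close>

definition pair_rotation :: "nat \<Rightarrow> nat \<Rightarrow> real \<Rightarrow> real \<Rightarrow> complex mat" where
  "pair_rotation n x a b = mat (2 ^ n) (2 ^ n) (\<lambda>(i, k).
     if k = i then if i = x \<or> i = complement_index n x then of_real a else 1
     else if k = complement_index n i
     then if i = x then of_real b else if i = complement_index n x then - of_real b else 0
     else 0)"

lemma pair_rotation_carrier [simp]: "pair_rotation n x a b \<in> carrier_mat (2 ^ n) (2 ^ n)"
  unfolding pair_rotation_def by auto

context
  fixes n x :: nat and a b :: real
  assumes n: "0 < n" and x: "x < 2 ^ n"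
begin

private definition \<alpha> :: "nat \<Rightarrow> complex" where
  "\<alpha> i = (if i = x \<or> i = complement_index n x then of_real a else 1)"

private definition \<beta> :: "nat \<Rightarrow> complex" where
  "\<beta> i = (if i = x then of_real b else if i = complement_index n x then - of_real b else 0)"

private lemma complement_eq_iff:
  "i < 2 ^ n \<Longrightarrow> j < 2 ^ n \<Longrightarrow> complement_index n i = j \<longleftrightarrow> i = complement_index n j"
  by auto

private lemma pair_rotation_index:
  "i < 2 ^ n \<Longrightarrow> k < 2 ^ n \<Longrightarrow> pair_rotation n x a b $$ (i, k)
     = (if k = i then \<alpha> i else if k = complement_index n i then \<beta> i else 0)"
  unfolding pair_rotation_def \<alpha>_def \<beta>_def by auto

private lemma sum_pair_rotation_row:
  assumes "i < 2 ^ n"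
  shows "(\<Sum>k < 2 ^ n. pair_rotation n x a b $$ (i, k) * h k)
       = \<alpha> i * h i + \<beta> i * h (complement_index n i)"
proof -
  have "(\<Sum>k < 2 ^ n. pair_rotation n x a b $$ (i, k) * h k)
      = (\<Sum>k \<in> {i, complement_index n i}. pair_rotation n x a b $$ (i, k) * h k)"
    using assms by (intro sum.mono_neutral_right) (auto simp: pair_rotation_index)
  then show ?thesis
    using assms complement_index_neq[OF n, of i] by (auto simp: pair_rotation_index)
qed

private lemma \<alpha>\<beta>_complement:
  assumes "i < 2 ^ n"
  shows "\<alpha> (complement_index n i) = \<alpha> i" "\<beta> (complement_index n i) = - \<beta> i"
  using assms x complement_index_neq[OF n, of x] complement_eq_iff[of i x] complement_eq_iff[of i "complement_index n x"]
  unfolding \<alpha>_def \<beta>_def by auto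

private lemma cnj_\<alpha>\<beta> [simp]: "cnj (\<alpha> i) = \<alpha> i" "cnj (\<beta> i) = \<beta> i"
  unfolding \<alpha>_def \<beta>_def by auto

text \<open>For odd n, \<open>Y_power n\<close> is a direct sum of antisymmetric 2 x 2 blocks, one
  on the plane of each index and its complement. A 2 x 2 matrix of determinant 1 preserves such a
  form, and the rotation has determinant a^2 + b^2 = 1.\<close>

lemma pair_rotation_symplectic:
  assumes "odd n" and ab: "a\<^sup>2 + b\<^sup>2 = 1"
  shows "pair_rotation n x a b \<in> symplectic_group n"
proof -
  let ?g = "pair_rotation n x a b" and ?c = "complement_index n"
  have "complex_of_real a * complex_of_real a + complex_of_real b * complex_of_real b = 1"
    using ab by (metis of_real_1 of_real_add of_real_mult power2_eq_square)
  then have norm: "\<alpha> i * \<alpha> i + \<beta> i * \<beta> i = 1" for i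
    unfolding \<alpha>_def \<beta>_def by auto
  have neq: "?c i \<noteq> i" for i by (rule complement_index_neq[OF n])
  have "?g \<in> unitary_group (2 ^ n)"
  proof (rule unitary_groupI)
    fix i j :: nat assume ij: "i < 2 ^ n" "j < 2 ^ n"
    have "(\<Sum>k < 2 ^ n. ?g $$ (i, k) * cnj (?g $$ (j, k)))
        = \<alpha> i * cnj (?g $$ (j, i)) + \<beta> i * cnj (?g $$ (j, ?c i))"
      using sum_pair_rotation_row[OF ij(1)] .
    also have "\<dots> = (if i = j then 1 else 0)"
    proof -
      consider "j = i" | "j = ?c i" "j \<noteq> i" | "j \<noteq> i" "j \<noteq> ?c i" by blast
      then show ?thesis
      proof cases
        case 1
        then show ?thesis using ij neq[of i] norm[of i] by (simp add: pair_rotation_index)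
      next
        case 2
        then show ?thesis using ij neq[of i] \<alpha>\<beta>_complement[OF ij(1)]
          by (auto simp: pair_rotation_index)
      next
        case 3
        then have "i \<noteq> ?c j" using ij by auto
        moreover have "?c i \<noteq> ?c j" using 3 ij by (metis complement_complement_index)
        ultimately show ?thesis using 3 ij by (auto simp: pair_rotation_index)
      qed
    qed
    finally show "(\<Sum>k < 2 ^ n. ?g $$ (i, k) * cnj (?g $$ (j, k))) = (if i = j then 1 else 0)" .
  qed auto
  moreover have "?g * Y_power n * transpose_mat ?g = Y_power n"
  proof (rule eq_matI)
    fix i j assume "i < dim_row (Y_power n)" "j < dim_col (Y_power n)"
    then have ij: "i < 2 ^ n" "j < 2 ^ n" by auto
    have "(?g * Y_power n * transpose_mat ?g) $$ (i, j)
        = (\<Sum>u < 2 ^ n. ?g $$ (i, u) * (\<Sum>v < 2 ^ n. ?g $$ (j, v) * Y_power n $$ (u, v)))"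
      using ij by (intro mat_sandwich_transpose_index) auto
    also have "\<dots> = \<alpha> i * (\<alpha> j * Y_power n $$ (i, j) + \<beta> j * Y_power n $$ (i, ?c j))
        + \<beta> i * (\<alpha> j * Y_power n $$ (?c i, j) + \<beta> j * Y_power n $$ (?c i, ?c j))"
      using ij by (simp add: sum_pair_rotation_row)
    also have "\<dots> = Y_power n $$ (i, j)"
    proof -
      have sgn: "Y_sign n (?c i) = - Y_sign n i" using assms(1) by (simp add: Y_sign_complement)
      consider "j = i" | "j = ?c i" "j \<noteq> i" | "j \<noteq> i" "j \<noteq> ?c i" by blast
      then show ?thesis
      proof cases
        case 1
        then show ?thesis using ij neq[of i] neq[of i, symmetric] sgn
          by (auto simp: Y_power_index_complement)
      next
        case 2
        \<comment> \<open>The only entry that survives is multiplied by the determinant of the 2 x 2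
          block.\<close>
        have "\<alpha> i * \<alpha> i * Y_sign n i + \<beta> i * \<beta> i * Y_sign n i
            = (\<alpha> i * \<alpha> i + \<beta> i * \<beta> i) * Y_sign n i" by (simp add: algebra_simps)
        then have "\<alpha> i * (\<alpha> i * Y_sign n i) + \<beta> i * (\<beta> i * Y_sign n i) = Y_sign n i"
          unfolding norm by (simp add: mult.assoc)
        then show ?thesis using 2 ij neq[of i] neq[of i, symmetric] sgn \<alpha>\<beta>_complement[OF ij(1)]
          by (auto simp: Y_power_index_complement)
      next
        case 3
        then have "i \<noteq> ?c j" using ij by auto
        moreover have "?c i \<noteq> ?c j" using 3 ij by (metis complement_complement_index)
        ultimately show ?thesis using 3 ij by (auto simp: Y_power_index_complement)
      qed
    qed
    finally show "(?g * Y_power n * transpose_mat ?g) $$ (i, j) = Y_power n $$ (i, j)" .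
  qed (auto simp: pair_rotation_def)
  ultimately show ?thesis unfolding symplectic_group_def by auto
qed

text \<open>Only the terms at x and at its complement change, and they coincide by the symmetry of
  the weights, whence the factor 2. For a = cos \<theta> and b = sin \<theta>, the product zw of the
  two amplitudes becomes zw cos 2\<theta> + (w^2 - z^2)/2 sin 2\<theta>, which explains the angles
  \<pi>/2 and \<pi>/4 used below.\<close>

lemma test_form_pair_rotation:
  assumes "odd n" "q < n" and U: "U \<in> carrier_mat (2 ^ n) (2 ^ n)"
  shows "test_form n q (pair_rotation n x a b * U) - test_form n q U
       = 2 * test_weight n q x *
         ((of_real a * U $$ (x, 0) + of_real b * U $$ (complement_index n x, 0))
          * (of_real a * U $$ (complement_index n x, 0) - of_real b * U $$ (x, 0))
          - U $$ (x, 0) * U $$ (complement_index n x, 0))"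
proof -
  let ?g = "pair_rotation n x a b" and ?c = "complement_index n"
  have neq: "?c x \<noteq> x" by (rule complement_index_neq[OF n])
  have entry: "(?g * U) $$ (i, 0) = \<alpha> i * U $$ (i, 0) + \<beta> i * U $$ (?c i, 0)" if "i < 2 ^ n" for i
  proof -
    have "(?g * U) $$ (i, 0) = (\<Sum>k < 2 ^ n. ?g $$ (i, k) * U $$ (k, 0))"
      using that U pair_rotation_carrier[of n x a b]
      by (auto simp: scalar_prod_def atLeast0LessThan simp del: pair_rotation_carrier)
    then show ?thesis using sum_pair_rotation_row[OF that] by simp
  qed
  define f where "f i = test_weight n q i *
    ((?g * U) $$ (i, 0) * (?g * U) $$ (?c i, 0) - U $$ (i, 0) * U $$ (?c i, 0))" for i
  have gU: "?g * U \<in> carrier_mat (2 ^ n) (2 ^ n)"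
    by (rule mult_carrier_mat[OF pair_rotation_carrier U])
  have "test_form n q (?g * U) - test_form n q U = (\<Sum>i < 2 ^ n. f i)"
    unfolding test_form_sum[OF gU] test_form_sum[OF U] f_def sum_subtractf[symmetric]
    by (simp add: algebra_simps)
  also have "\<dots> = (\<Sum>i \<in> {x, ?c x}. f i)"
  proof (rule sum.mono_neutral_right)
    show "\<forall>i \<in> {..<2 ^ n} - {x, ?c x}. f i = 0"
    proof
      fix i assume i: "i \<in> {..<2 ^ n} - {x, ?c x}"
      then have "?c i \<noteq> x" "?c i \<noteq> ?c x" using complement_eq_iff[of i x] complement_eq_iff[of i "?c x"] x by auto
      then show "f i = 0" using i x unfolding f_def by (simp add: entry \<alpha>_def \<beta>_def)
    qed
  qed (use x in auto)
  also have "\<dots> = f x + f (?c x)" using neq by simp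
  also have "f (?c x) = f x"
    using x test_weight_complement[OF assms(1,2) x] by (simp add: f_def mult.commute)
  finally show ?thesis
    unfolding f_def using x neq by (simp add: entry \<alpha>_def \<beta>_def)
qed

end

text \<open>
  With \<open>z\<close>, \<open>w\<close> the amplitudes of a basis state and of its complement, rotating the pair by
  \<open>\<pi>/2\<close> forces \<open>z w = 0\<close> and rotating by \<open>\<pi>/4\<close> forces \<open>w\<^sup>2 = z\<^sup>2\<close>.
\<close>

lemma test_form_pair_rotations_not_all_zero:
  assumes n: "odd n" "q < n" and U: "U \<in> symplectic_group n"
    and zero: "test_form n q U = 0"
    and zero1: "\<And>x. x < 2 ^ n \<Longrightarrow> test_form n q (pair_rotation n x 0 1 * U) = 0"
    and zero2: "\<And>x. x < 2 ^ n \<Longrightarrow>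
      test_form n q (pair_rotation n x (1 / sqrt 2) (1 / sqrt 2) * U) = 0"
  shows False
proof -
  have c: "U \<in> carrier_mat (2 ^ n) (2 ^ n)" by (rule symplectic_group_carrier[OF U])
  have pos: "0 < n" using n by auto
  have "U $$ (x, 0) = 0" if x: "x < 2 ^ n" for x
  proof -
    define z where "z = U $$ (x, 0)"
    define w where "w = U $$ (complement_index n x, 0)"
    have "z * w = 0"
      using test_form_pair_rotation[OF pos x n c, of 0 1] zero zero1[OF x]
      by (auto simp: z_def w_def test_weight_nonzero)
    moreover have half: "complex_of_real (1 / sqrt 2) * complex_of_real (1 / sqrt 2) = 1 / 2"
      by (simp flip: of_real_mult)
    have "(of_real (1 / sqrt 2) * z + of_real (1 / sqrt 2) * w)
        * (of_real (1 / sqrt 2) * w - of_real (1 / sqrt 2) * z) - z * w = 0"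
      using test_form_pair_rotation[OF pos x n c, of "1 / sqrt 2" "1 / sqrt 2"] zero zero2[OF x]
      by (simp add: z_def w_def test_weight_nonzero)
    then have "(of_real (1 / sqrt 2) * of_real (1 / sqrt 2)) * ((z + w) * (w - z)) - z * w = 0"
      by (simp only: algebra_simps)
    ultimately have "(z + w) * (w - z) = 0" unfolding half by simp
    \<comment> \<open>Either w = z or w = -z, and both leave z = 0 when zw = 0.\<close>
    then show ?thesis using \<open>z * w = 0\<close> unfolding z_def[symmetric] by auto
  qed
  moreover have "U \<in> unitary_group (2 ^ n)" using U unfolding symplectic_group_def by auto
  ultimately show False using unitary_group_col_nonzero[of U "2 ^ n" 0] by auto
qed

section \<open>Measurability and invariance of the Haar measure\<close>

lemma haar_USp_entry_measurable:
  assumes "haar_USp n H" "i < 2 ^ n" "j < 2 ^ n"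
  shows "(\<lambda>U. U $$ (i, j)) \<in> borel_measurable H"
proof (rule measurableI)
  fix B :: "complex set" assume "B \<in> sets borel"
  then have "{U \<in> USp n. U $$ (i, j) \<in> B} \<in> mat_borel_sets (2 ^ n) (USp n)"
    unfolding mat_borel_sets_def using assms(2,3) by (intro sigma_sets.Basic) blast
  moreover have "(\<lambda>U. U $$ (i, j)) -` B \<inter> USp n = {U \<in> USp n. U $$ (i, j) \<in> B}" by auto
  ultimately show "(\<lambda>U. U $$ (i, j)) -` B \<inter> space H \<in> sets H"
    using assms(1) unfolding haar_USp_def by simp
qed auto

text \<open>Entries of g U are linear combinations of entries of U, so preimages of the generating
  sets are measurable. This allows almost-sure statements to be pulled back along the invariance
  stated with \<open>distr\<close>.\<close>

lemma haar_USp_translation_measurable: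
  assumes H: "haar_USp n H" and g: "g \<in> USp n"
  shows "(\<lambda>U. g * U) \<in> measurable H H"
proof -
  have H': "space H = USp n" "sets H = mat_borel_sets (2 ^ n) (USp n)"
    using H unfolding haar_USp_def by auto
  have carrier: "U \<in> carrier_mat (2 ^ n) (2 ^ n)" if "U \<in> USp n" for U
    using that symplectic_group_carrier unfolding USp_eq_symplectic_group by auto
  let ?G = "{{U \<in> USp n. U $$ (i, j) \<in> B} | i j B. i < 2 ^ n \<and> j < 2 ^ n \<and> B \<in> sets (borel :: complex measure)}"
  show ?thesis
  proof (rule measurable_sigma_sets[of H "USp n" ?G])
    show "sets H = sigma_sets (USp n) ?G" using H' unfolding mat_borel_sets_def by simp
    show "?G \<subseteq> Pow (USp n)" by auto
    show gU: "(\<lambda>U. g * U) \<in> space H \<rightarrow> USp n"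
      using g symplectic_group_mult unfolding H' USp_eq_symplectic_group by auto
    fix A assume "A \<in> ?G"
    then obtain i j B where A: "A = {U \<in> USp n. U $$ (i, j) \<in> B}"
      and ij: "i < 2 ^ n" "j < 2 ^ n" and B: "B \<in> sets (borel :: complex measure)" by auto
    have "(g * U) $$ (i, j) = (\<Sum>k < 2 ^ n. g $$ (i, k) * U $$ (k, j))" if "U \<in> USp n" for U
      using carrier[OF g] carrier[OF that] ij by (auto simp: scalar_prod_def atLeast0LessThan)
    then have "(\<lambda>U. g * U) -` A \<inter> space H
        = (\<lambda>U. \<Sum>k < 2 ^ n. g $$ (i, k) * U $$ (k, j)) -` B \<inter> space H"
      using gU unfolding A H' by auto
    also have "\<dots> \<in> sets H"
      using haar_USp_entry_measurable[OF H _ ij(2)] B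
      by (intro measurable_sets[of _ H borel] borel_measurable_sum borel_measurable_times) auto
    finally show "(\<lambda>U. g * U) -` A \<inter> space H \<in> sets H" .
  qed
qed

lemma haar_USp_test_form_nonzero:
  assumes n: "odd n" "q < n" and H: "haar_USp n H"
  shows "\<not> (AE U in H. test_form n q U = 0)"
proof
  assume AE: "AE U in H. test_form n q U = 0"
  interpret prob_space H using H unfolding haar_USp_def by auto
  have space: "space H = symplectic_group n"
    using H unfolding haar_USp_def USp_eq_symplectic_group by auto
  have shift: "AE U in H. test_form n q (g * U) = 0" if "g \<in> symplectic_group n" for g
  proof -
    have g: "g \<in> USp n" using that unfolding USp_eq_symplectic_group .
    then have distr: "distr H H (\<lambda>U. g * U) = H" using H unfolding haar_USp_def by auto
    show ?thesis
      by (rule AE_distrD[OF haar_USp_translation_measurable[OF H g]]) (subst distr, rule AE)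
  qed
  \<comment> \<open>Each rotation has its own null set; as x ranges over finitely many indices, the
    union is still null.\<close>
  have "AE U in H. \<forall>x \<in> {..<2 ^ n}. test_form n q (pair_rotation n x 0 1 * U) = 0"
    using n by (subst AE_finite_all) (auto intro!: shift pair_rotation_symplectic)
  moreover have "AE U in H. \<forall>x \<in> {..<2 ^ n}.
      test_form n q (pair_rotation n x (1 / sqrt 2) (1 / sqrt 2) * U) = 0"
    using n by (subst AE_finite_all) (auto intro!: shift pair_rotation_symplectic simp: power_divide)
  ultimately have "AE U in H. False"
    using AE AE_space
  proof eventually_elim
    case (elim U)
    then show ?case
      using test_form_pair_rotations_not_all_zero[OF n, of U] space by auto
  qed
  then show False by simp
qed

subsection \<open>Second moments detect the test form\<close>

lemma quadratic_form_sum: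
  fixes A :: "complex mat"
  assumes "A \<in> carrier_mat m m" "v \<in> carrier_vec m"
  shows "(A *\<^sub>v v) \<bullet>c v = (\<Sum>i < m. \<Sum>j < m. A $$ (i, j) * v $ j * cnj (v $ i))"
  using assms
  by (auto simp: scalar_prod_def atLeast0LessThan sum_distrib_right conjugate_complex_def
      intro!: sum.cong)

text \<open>X is the rank-one matrix of \<phi>, so its quadratic form at v is the squared modulus of
  the pairing of \<phi> with v. The bound by 1 makes every entry integrable, so the finite sums
  commute with the integral.\<close>

lemma mat_expectation_quadratic_form:
  assumes P: "prob_space P"
    and \<phi>: "\<And>i. i < m \<Longrightarrow> \<phi> i \<in> borel_measurable P"
    and bound: "\<And>i \<omega>. i < m \<Longrightarrow> \<omega> \<in> space P \<Longrightarrow> cmod (\<phi> i \<omega>) \<le> 1"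
    and X: "\<And>i j \<omega>. i < m \<Longrightarrow> j < m \<Longrightarrow> \<omega> \<in> space P \<Longrightarrow> X \<omega> $$ (i, j) = \<phi> i \<omega> * cnj (\<phi> j \<omega>)"
    and v: "v \<in> carrier_vec m"
  shows "integrable P (\<lambda>\<omega>. (cmod (\<Sum>i < m. \<phi> i \<omega> * cnj (v $ i)))\<^sup>2)"
    and "(mat_expectation P m X *\<^sub>v v) \<bullet>c v
       = of_real (\<integral>\<omega>. (cmod (\<Sum>i < m. \<phi> i \<omega> * cnj (v $ i)))\<^sup>2 \<partial>P)"
proof -
  interpret prob_space P by fact
  have int: "integrable P (\<lambda>\<omega>. \<phi> i \<omega> * cnj (\<phi> j \<omega>))" if "i < m" "j < m" for i j
  proof (rule integrable_const_bound[where B = 1])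
    show "AE \<omega> in P. norm (\<phi> i \<omega> * cnj (\<phi> j \<omega>)) \<le> 1"
    proof (rule AE_I2)
      fix \<omega> assume "\<omega> \<in> space P"
      then show "norm (\<phi> i \<omega> * cnj (\<phi> j \<omega>)) \<le> 1"
        using mult_mono[OF bound[of i \<omega>] bound[of j \<omega>]] that by (simp add: norm_mult)
    qed
    show "(\<lambda>\<omega>. \<phi> i \<omega> * cnj (\<phi> j \<omega>)) \<in> borel_measurable P"
      using \<phi>[OF that(1)] \<phi>[OF that(2)]
      by (intro borel_measurable_times borel_measurable_continuous_on[of cnj] continuous_intros)
  qed
  have sq: "complex_of_real ((cmod (\<Sum>i < m. \<phi> i \<omega> * cnj (v $ i)))\<^sup>2)
      = (\<Sum>i < m. \<Sum>j < m. \<phi> i \<omega> * cnj (\<phi> j \<omega>) * v $ j * cnj (v $ i))" for \<omega>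
    unfolding complex_norm_square cnj_sum sum_product
    by (intro sum.cong refl) (simp add: mult_ac)
  have "integrable P (\<lambda>\<omega>. complex_of_real ((cmod (\<Sum>i < m. \<phi> i \<omega> * cnj (v $ i)))\<^sup>2))"
    unfolding sq
    by (intro Bochner_Integration.integrable_sum integrable_mult_left int) auto
  then show "integrable P (\<lambda>\<omega>. (cmod (\<Sum>i < m. \<phi> i \<omega> * cnj (v $ i)))\<^sup>2)"
    by (simp only: complex_of_real_integrable_eq)
  have E: "mat_expectation P m X $$ (i, j) = (\<integral>\<omega>. \<phi> i \<omega> * cnj (\<phi> j \<omega>) \<partial>P)" if "i < m" "j < m" for i j
    unfolding mat_expectation_def using that X
    by (auto intro!: Bochner_Integration.integral_cong)
  have Ec: "mat_expectation P m X \<in> carrier_mat m m" unfolding mat_expectation_def by simp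
  have "(mat_expectation P m X *\<^sub>v v) \<bullet>c v
      = (\<Sum>i < m. \<Sum>j < m. (\<integral>\<omega>. \<phi> i \<omega> * cnj (\<phi> j \<omega>) * v $ j * cnj (v $ i) \<partial>P))"
    unfolding quadratic_form_sum[OF Ec v] by (intro sum.cong refl) (simp add: E int)
  also have "\<dots> = (\<integral>\<omega>. (\<Sum>i < m. \<Sum>j < m. \<phi> i \<omega> * cnj (\<phi> j \<omega>) * v $ j * cnj (v $ i)) \<partial>P)"
    by (subst Bochner_Integration.integral_sum;
        (intro Bochner_Integration.integrable_sum integrable_mult_left int sum.cong refl)?)
       (auto simp: Bochner_Integration.integral_sum int)
  also have "\<dots> = of_real (\<integral>\<omega>. (cmod (\<Sum>i < m. \<phi> i \<omega> * cnj (v $ i)))\<^sup>2 \<partial>P)"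
    unfolding sq[symmetric] by (rule integral_complex_of_real)
  finally show "(mat_expectation P m X *\<^sub>v v) \<bullet>c v
       = of_real (\<integral>\<omega>. (cmod (\<Sum>i < m. \<phi> i \<omega> * cnj (v $ i)))\<^sup>2 \<partial>P)" .
qed

section \<open>Two copies of a state and their pairing with the test vector\<close>

lemma sum_div_mod:
  fixes f :: "nat \<Rightarrow> nat \<Rightarrow> complex"
  assumes "0 < N"
  shows "(\<Sum>i < N * N. f (i div N) (i mod N)) = (\<Sum>x < N. \<Sum>y < N. f x y)"
proof -
  have lt: "x * N + y < N * N" if "x < N" "y < N" for x y
  proof -
    have "x * N + y < Suc x * N" using that by simp
    also have "\<dots> \<le> N * N" using that by (intro mult_right_mono) auto
    finally show ?thesis .
  qed
  have "(\<Sum>i < N * N. f (i div N) (i mod N)) = (\<Sum>(x, y) \<in> {..<N} \<times> {..<N}. f x y)"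
    using assms lt
    by (intro sum.reindex_bij_witness[of _ "\<lambda>(x, y). x * N + y" "\<lambda>i. (i div N, i mod N)"])
       (auto simp: less_mult_imp_div_less)
  then show ?thesis by (simp add: sum.cartesian_product)
qed

definition two_copy_amplitude :: "nat \<Rightarrow> nat \<Rightarrow> complex mat \<Rightarrow> complex" where
  "two_copy_amplitude n i U = U $$ (i div 2 ^ n, 0) * U $$ (i mod 2 ^ n, 0)"

text \<open>The test matrix written as one vector. It is conjugated because
  \<open>\<bullet>c\<close> conjugates its second argument, so that pairing with the two-copy state
  returns the unconjugated form.\<close>

definition test_vector :: "nat \<Rightarrow> nat \<Rightarrow> complex vec" where
  "test_vector n q = vec (2 ^ n * 2 ^ n) (\<lambda>i. cnj (test_matrix n q $$ (i div 2 ^ n, i mod 2 ^ n)))"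

lemma sum_two_copy_amplitude_test_vector:
  assumes "U \<in> carrier_mat (2 ^ n) (2 ^ n)"
  shows "(\<Sum>i < 2 ^ n * 2 ^ n. two_copy_amplitude n i U * cnj (test_vector n q $ i)) = test_form n q U"
  unfolding test_form_double_sum[OF assms]
  by (subst sum_div_mod[symmetric]) (auto simp: two_copy_amplitude_def test_vector_def)

text \<open>Stated for an arbitrary random unitary u, as it serves both the circuit ensemble and the
  Haar measure, where u is the identity map.\<close>

lemma moment_test_vector:
  assumes P: "prob_space P"
    and u: "\<And>\<omega>. \<omega> \<in> space P \<Longrightarrow> u \<omega> \<in> symplectic_group n"
    and meas: "\<And>i. i < 2 ^ n \<Longrightarrow> (\<lambda>\<omega>. u \<omega> $$ (i, 0)) \<in> borel_measurable P"
    and X: "\<And>i j \<omega>. i < 2 ^ n * 2 ^ n \<Longrightarrow> j < 2 ^ n * 2 ^ n \<Longrightarrow> \<omega> \<in> space P \<Longrightarrow>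
      X \<omega> $$ (i, j) = two_copy_amplitude n i (u \<omega>) * cnj (two_copy_amplitude n j (u \<omega>))"
  shows "integrable P (\<lambda>\<omega>. (cmod (test_form n q (u \<omega>)))\<^sup>2)"
    and "(mat_expectation P (2 ^ n * 2 ^ n) X *\<^sub>v test_vector n q) \<bullet>c test_vector n q
       = of_real (\<integral>\<omega>. (cmod (test_form n q (u \<omega>)))\<^sup>2 \<partial>P)"
proof -
  let ?N = "2 ^ n :: nat" and ?\<phi> = "\<lambda>i \<omega>. two_copy_amplitude n i (u \<omega>)"
  have div: "i div ?N < ?N" if "i < ?N * ?N" for i using that by (rule less_mult_imp_div_less)
  have \<phi>: "?\<phi> i \<in> borel_measurable P" if "i < ?N * ?N" for i
    unfolding two_copy_amplitude_def using meas[OF div[OF that]] meas[of "i mod ?N"]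
    by (intro borel_measurable_times) auto
  have bound: "cmod (?\<phi> i \<omega>) \<le> 1" if "i < ?N * ?N" "\<omega> \<in> space P" for i \<omega>
  proof -
    have "u \<omega> \<in> unitary_group ?N" using u[OF that(2)] unfolding symplectic_group_def by auto
    from unitary_group_entry_le_1[OF this div[OF that(1)], of 0]
      unitary_group_entry_le_1[OF this, of "i mod ?N" 0]
    show ?thesis using mult_mono[of "cmod (u \<omega> $$ (i div ?N, 0))" 1 "cmod (u \<omega> $$ (i mod ?N, 0))" 1]
      by (simp add: two_copy_amplitude_def norm_mult)
  qed
  have v: "test_vector n q \<in> carrier_vec (?N * ?N)" unfolding test_vector_def by auto
  have form: "(\<Sum>i < ?N * ?N. ?\<phi> i \<omega> * cnj (test_vector n q $ i)) = test_form n q (u \<omega>)"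
    if "\<omega> \<in> space P" for \<omega>
    using sum_two_copy_amplitude_test_vector symplectic_group_carrier u[OF that] by blast
  note quad = mat_expectation_quadratic_form[where \<phi> = ?\<phi>, OF P \<phi> bound X v]
  show "integrable P (\<lambda>\<omega>. (cmod (test_form n q (u \<omega>)))\<^sup>2)"
    using quad(1) by (simp add: form cong: Bochner_Integration.integrable_cong)
  show "(mat_expectation P (2 ^ n * 2 ^ n) X *\<^sub>v test_vector n q) \<bullet>c test_vector n q
       = of_real (\<integral>\<omega>. (cmod (test_form n q (u \<omega>)))\<^sup>2 \<partial>P)"
    using quad(2) by (simp add: form cong: Bochner_Integration.integral_cong)
qed

lemma kron_ket_bra_state_index:
  assumes U: "U \<in> carrier_mat (2 ^ n) (2 ^ n)" and ij: "i < 2 ^ n * 2 ^ n" "j < 2 ^ n * 2 ^ n"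
  shows "kron (ket_bra (U *\<^sub>v zero_state n)) (ket_bra (U *\<^sub>v zero_state n)) $$ (i, j)
       = two_copy_amplitude n i U * cnj (two_copy_amplitude n j U)"
proof -
  have "ket_bra (U *\<^sub>v zero_state n) $$ (a, b) = U $$ (a, 0) * cnj (U $$ (b, 0))"
    if "a < 2 ^ n" "b < 2 ^ n" for a b
    using that U unfolding ket_bra_def zero_state_def by (auto simp: conjugate_complex_def)
  moreover have "dim_row (ket_bra (U *\<^sub>v zero_state n)) = 2 ^ n" "dim_col (ket_bra (U *\<^sub>v zero_state n)) = 2 ^ n"
    using U unfolding ket_bra_def by auto
  ultimately show ?thesis
    using ij unfolding kron_def two_copy_amplitude_def by (simp add: less_mult_imp_div_less)
qed

text \<open>The two-copy zero state has a single nonzero matrix entry, so only column 0 of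
  \<open>kron U U\<close> contributes. The result has the same shape as the integrand of the Haar
  moment.\<close>

lemma second_moment_zero_state_index:
  assumes U: "U \<in> carrier_mat (2 ^ n) (2 ^ n)" and ij: "i < 2 ^ n * 2 ^ n" "j < 2 ^ n * 2 ^ n"
  shows "(kron U U * kron (ket_bra (zero_state n)) (ket_bra (zero_state n)) * mat_adjoint (kron U U)) $$ (i, j)
       = two_copy_amplitude n i U * cnj (two_copy_amplitude n j U)"
proof -
  let ?N = "2 ^ n :: nat" let ?M = "?N * ?N"
  define K where "K = kron U U"
  define A where "A = kron (ket_bra (zero_state n)) (ket_bra (zero_state n))"
  have Kc: "K \<in> carrier_mat ?M ?M" unfolding K_def kron_def using U by auto
  have Ac: "A \<in> carrier_mat ?M ?M" unfolding A_def kron_def ket_bra_def zero_state_def by auto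
  have A: "A $$ (k, l) = (if k = 0 \<and> l = 0 then 1 else 0)" if "k < ?M" "l < ?M" for k l
  proof -
    have zero_iff: "m = 0 \<longleftrightarrow> m div ?N = 0 \<and> m mod ?N = 0" for m
      using div_mult_mod_eq[of m ?N] by auto
    have kb: "ket_bra (zero_state n) $$ (a, b) = (if a = 0 \<and> b = 0 then 1 else 0)"
      if "a < ?N" "b < ?N" for a b
      using that unfolding ket_bra_def zero_state_def by auto
    have dim: "dim_row (ket_bra (zero_state n)) = ?N" "dim_col (ket_bra (zero_state n)) = ?N"
      unfolding ket_bra_def zero_state_def by auto
    have "A $$ (k, l) = ket_bra (zero_state n) $$ (k div ?N, l div ?N)
        * ket_bra (zero_state n) $$ (k mod ?N, l mod ?N)"
      using that unfolding A_def kron_def by (simp add: dim)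
    also have "\<dots> = (if k = 0 \<and> l = 0 then 1 else 0)"
      using that by (subst (1 2) kb) (auto simp: less_mult_imp_div_less zero_iff[of k] zero_iff[of l])
    finally show ?thesis .
  qed
  have K: "K $$ (k, 0) = two_copy_amplitude n k U" if "k < ?M" for k
    using that U unfolding K_def kron_def two_copy_amplitude_def by auto
  have KA: "(K * A) $$ (i, l) = (if l = 0 then K $$ (i, 0) else 0)" if "l < ?M" for l
  proof -
    have "(K * A) $$ (i, l) = (\<Sum>k < ?M. K $$ (i, k) * A $$ (k, l))"
      using ij that Kc Ac by (auto simp: scalar_prod_def atLeast0LessThan)
    also have "\<dots> = (\<Sum>k < ?M. if k = 0 then if l = 0 then K $$ (i, 0) else 0 else 0)"
      using that by (intro sum.cong) (auto simp: A)
    finally show ?thesis by simp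
  qed
  have "(K * A * mat_adjoint K) $$ (i, j) = (\<Sum>l < ?M. (K * A) $$ (i, l) * cnj (K $$ (j, l)))"
    using ij mult_carrier_mat[OF Kc Ac] mat_adjoint_carrier[OF Kc]
    by (subst mat_mult_index[of _ ?M ?M _ ?M]) (auto simp: mat_adjoint_index[OF Kc] intro!: sum.cong)
  also have "\<dots> = (\<Sum>l < ?M. if l = 0 then K $$ (i, 0) * cnj (K $$ (j, 0)) else 0)"
    by (intro sum.cong) (auto simp: KA)
  finally show ?thesis using ij K unfolding K_def[symmetric] A_def[symmetric] by simp
qed

text \<open>If the form vanished almost surely, the ensemble moment would be zero at the test
  vector, while the Haar moment is there the mean of a nonnegative function that is not almost
  surely zero. With 1 - \<epsilon> > 0 this violates the lower Loewner bound.\<close>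

lemma design_test_form_nonzero:
  assumes n: "odd n" "q < n" and E: "symplectic_ensemble n G k E"
    and "\<epsilon> < 1" and design: "state_2_design_ensemble n \<epsilon> E"
  shows "\<not> (AE C in E. test_form n q (circuit_unitary n C) = 0)"
proof
  assume AE: "AE C in E. test_form n q (circuit_unitary n C) = 0"
  let ?M = "2 ^ n * 2 ^ n :: nat" and ?v = "test_vector n q"
  define \<rho> where "\<rho> = second_moment_map n E (circuit_unitary n)
        (kron (ket_bra (zero_state n)) (ket_bra (zero_state n)))"
  obtain H where H: "haar_USp n H"
    and le: "loewner_le (complex_of_real (1 - \<epsilon>) \<cdot>\<^sub>m haar_state_moment n H) \<rho>"
    using design unfolding state_2_design_ensemble_def relative_state_2_design_def \<rho>_def by auto
  define \<sigma> where "\<sigma> = haar_state_moment n H"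
  have spaceH: "space H = symplectic_group n" and PH: "prob_space H"
    using H unfolding haar_USp_def USp_eq_symplectic_group by auto
  have PE: "prob_space E" using E unfolding symplectic_ensemble_def by auto
  have circ: "circuit_unitary n C \<in> symplectic_group n" if "C \<in> space E" for C
    using E that circuit_unitary_symplectic unfolding symplectic_ensemble_def by blast
  have \<rho>: "(\<rho> *\<^sub>v ?v) \<bullet>c ?v = of_real (\<integral>C. (cmod (test_form n q (circuit_unitary n C)))\<^sup>2 \<partial>E)"
    unfolding \<rho>_def second_moment_map_def
    using E unfolding symplectic_ensemble_def
    by (intro moment_test_vector(2)[OF PE circ] second_moment_zero_state_index
        symplectic_group_carrier[OF circ]) auto
  have "(\<integral>C. (cmod (test_form n q (circuit_unitary n C)))\<^sup>2 \<partial>E) = 0"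
    using AE by (intro integral_eq_zero_AE) auto
  with \<rho> have \<rho>0: "(\<rho> *\<^sub>v ?v) \<bullet>c ?v = 0" by simp
  note \<sigma>_moment = moment_test_vector[OF PH, of "\<lambda>U. U" n
      "\<lambda>U. kron (ket_bra (U *\<^sub>v zero_state n)) (ket_bra (U *\<^sub>v zero_state n))" q]
  have int: "integrable H (\<lambda>U. (cmod (test_form n q U))\<^sup>2)"
    and \<sigma>: "(\<sigma> *\<^sub>v ?v) \<bullet>c ?v = of_real (\<integral>U. (cmod (test_form n q U))\<^sup>2 \<partial>H)"
    unfolding \<sigma>_def haar_state_moment_def
    by (intro \<sigma>_moment; (simp add: spaceH haar_USp_entry_measurable[OF H]
          kron_ket_bra_state_index symplectic_group_carrier))+
  have c: "\<sigma> \<in> carrier_mat ?M ?M" "\<rho> \<in> carrier_mat ?M ?M" "?v \<in> carrier_vec ?M"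
    unfolding \<sigma>_def \<rho>_def haar_state_moment_def second_moment_map_def mat_expectation_def test_vector_def
    by auto
  have "((\<rho> - complex_of_real (1 - \<epsilon>) \<cdot>\<^sub>m \<sigma>) *\<^sub>v ?v) \<bullet>c ?v
      = (\<rho> *\<^sub>v ?v) \<bullet>c ?v - complex_of_real (1 - \<epsilon>) * ((\<sigma> *\<^sub>v ?v) \<bullet>c ?v)"
  proof -
    have "\<rho> - complex_of_real (1 - \<epsilon>) \<cdot>\<^sub>m \<sigma> \<in> carrier_mat ?M ?M" using c by auto
    from quadratic_form_sum[OF this c(3)] show ?thesis
      unfolding quadratic_form_sum[OF c(1,3)] quadratic_form_sum[OF c(2,3)]
      using c by (simp add: sum_distrib_left sum_subtractf[symmetric] algebra_simps)
  qed
  moreover have "0 \<le> ((\<rho> - complex_of_real (1 - \<epsilon>) \<cdot>\<^sub>m \<sigma>) *\<^sub>v ?v) \<bullet>c ?v"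
    using le c unfolding loewner_le_def \<sigma>_def[symmetric] by auto
  ultimately have "0 \<le> complex_of_real (- ((1 - \<epsilon>) * (\<integral>U. (cmod (test_form n q U))\<^sup>2 \<partial>H)))"
    unfolding \<rho>0 \<sigma> by simp
  then have "(1 - \<epsilon>) * (\<integral>U. (cmod (test_form n q U))\<^sup>2 \<partial>H) \<le> 0"
    by (simp add: less_eq_complex_def)
  then have "(\<integral>U. (cmod (test_form n q U))\<^sup>2 \<partial>H) \<le> 0"
    using \<open>\<epsilon> < 1\<close> by (simp add: mult_le_0_iff)
  then have "(\<integral>U. (cmod (test_form n q U))\<^sup>2 \<partial>H) = 0"
    by (intro antisym Bochner_Integration.integral_nonneg) auto
  then have "AE U in H. test_form n q U = 0"
    using int by (subst (asm) integral_nonneg_eq_0_iff_AE) auto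
  then show False using haar_USp_test_form_nonzero[OF n H] by blast
qed

subsection \<open>Full lightcones and depth bounds\<close>

lemma design_frequently_full_backward_lightcone:
  assumes "odd n" "q < n" and E: "symplectic_ensemble n G k E"
    and "\<epsilon> < 1" "state_2_design_ensemble n \<epsilon> E"
  shows "\<exists>\<^sub>F C in ae_filter E. {..<n} \<subseteq> backward_lightcone C q"
proof (rule ccontr)
  assume "\<not> ?thesis"
  then have "AE C in E. \<not> {..<n} \<subseteq> backward_lightcone C q"
    unfolding frequently_def by simp
  then have "AE C in E. test_form n q (circuit_unitary n C) = 0"
    using AE_space
  proof eventually_elim
    case (elim C)
    then obtain p where "p < n" "q \<notin> lightcone C p" using mem_backward_lightcone by blast
    moreover have "local_symplectic_circuit n G k C"
      using E elim unfolding symplectic_ensemble_def by auto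
    ultimately show ?case using test_form_eq_0 assms(2) by blast
  qed
  then show False using design_test_form_nonzero[OF assms] by blast
qed

text \<open>Reaching p from q means that q lies in the backward lightcone of p, so the full backward
  lightcone of p settles this one target. With a single layout the lightcone is the same for all
  circuits, and a statement independent of the circuit that holds with positive probability simply
  holds.\<close>

lemma design_full_lightcones:
  assumes "odd n" and E: "symplectic_ensemble n G k E"
    and "\<epsilon> < 1" "state_2_design_ensemble n \<epsilon> E"
  shows "full_lightcones n E"
proof -
  have full: "\<exists>\<^sub>F C in ae_filter E. {..<n} \<subseteq> backward_lightcone C q" if "q < n" for q
    using design_frequently_full_backward_lightcone assms that by blast
  have mem: "\<exists>\<^sub>F C in ae_filter E. p \<in> lightcone C q" if "q < n" "p < n" for p q
    using full[OF that(2)] by (rule frequently_elim1) (use that mem_backward_lightcone in blast)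
  have "{..<n} \<subseteq> lightcone C q"
    if layouts: "\<forall>C \<in> space E. \<forall>C' \<in> space E. layout C = layout C'" and C: "C \<in> space E" and "q < n" for C q
  proof
    fix p assume "p \<in> {..<n}"
    then have "\<exists>\<^sub>F C' in ae_filter E. p \<in> lightcone C' q" using mem that by auto
    moreover have "AE C' in E. p \<in> lightcone C' q \<longrightarrow> p \<in> lightcone C q"
      using AE_space
    proof eventually_elim
      case (elim C')
      then have "layout C = layout C'" using layouts C by blast
      from lightcone_cong_layout[OF this] show ?case by simp
    qed
    ultimately have "\<exists>\<^sub>F C' in ae_filter E. p \<in> lightcone C q"
      by (rule frequently_rev_mp)
    then show "p \<in> lightcone C q" by (auto simp: frequently_const_iff)
  qed
  with full mem show ?thesis unfolding full_lightcones_def by blast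
qed

lemma design_exists_full_lightcone:
  assumes "odd n" and E: "symplectic_ensemble n G k E" and d: "has_depth E d"
    and "\<epsilon> < 1" "state_2_design_ensemble n \<epsilon> E"
  obtains C where "local_symplectic_circuit n G k C" "length C \<le> d" "{..<n} \<subseteq> lightcone C 0"
proof -
  have "0 < n" using assms(1) by (cases n) auto
  have "\<exists>C \<in> space E. {..<n} \<subseteq> backward_lightcone C 0"
  proof (rule ccontr)
    assume "\<not> ?thesis"
    then have "AE C in E. \<not> {..<n} \<subseteq> backward_lightcone C 0" by (intro AE_I2) auto
    then show False
      using design_frequently_full_backward_lightcone[OF assms(1) \<open>0 < n\<close> E assms(4,5)]
      unfolding frequently_def by simp
  qed
  then obtain C where C: "C \<in> space E" "{..<n} \<subseteq> lightcone (rev C) 0"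
    unfolding backward_lightcone_def by auto
  \<comment> \<open>Reversal preserves locality and length, so the growth bounds for forward
    lightcones apply to \<open>rev C\<close>.\<close>
  then have "local_symplectic_circuit n G k (rev C)" "length (rev C) \<le> d"
    using E d unfolding symplectic_ensemble_def has_depth_def local_symplectic_circuit_def by auto
  with C that show thesis by blast
qed

lemma ring_depth_bound:
  assumes "local_symplectic_circuit n G k C" "G \<subseteq> ring_graph n" "{..<n} \<subseteq> lightcone C 0"
  shows "n \<le> 2 * (length C * (k * k)) + 1"
proof (cases "n = 0")
  case False
  have "{..<n} \<subseteq> {y. ring_near n (length C * (k * k)) 0 y}"
    using lightcone_ring_near[OF assms(1,2), of 0] assms(3) False by auto
  from card_mono[OF ring_near_card(1) this] ring_near_card(2) show ?thesis
    by (metis card_lessThan order_trans)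
qed auto

lemma all_to_all_depth_bound:
  assumes "local_symplectic_circuit n G k C" "{..<n} \<subseteq> lightcone C 0"
  shows "n \<le> (k + 2) ^ length C"
  using card_mono[OF card_lightcone_le(1)[OF assms(1)] assms(2)] card_lightcone_le(2)[OF assms(1), of 0]
  by simp

theorem theoremS25:
  shows
    "(\<forall>n G k d \<epsilon> E. odd n \<longrightarrow> architecture n G \<longrightarrow> symplectic_ensemble n G k E \<longrightarrow> has_depth E d \<longrightarrow>
        \<epsilon> < 1 \<longrightarrow> state_2_design_ensemble n \<epsilon> E \<longrightarrow> full_lightcones n E)
     \<and>
     (\<forall>k. \<exists>c > 0. \<exists>N. \<forall>n \<ge> N. \<forall>G \<in> {line_graph n, ring_graph n}. \<forall>d \<epsilon> E.
        odd n \<longrightarrow> symplectic_ensemble n G k E \<longrightarrow> has_depth E d \<longrightarrow>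
        \<epsilon> < 1 \<longrightarrow> state_2_design_ensemble n \<epsilon> E \<longrightarrow> real d \<ge> c * real n)
     \<and>
     (\<forall>k. \<exists>c > 0. \<exists>N. \<forall>n \<ge> N. \<forall>d \<epsilon> E.
        odd n \<longrightarrow> symplectic_ensemble n (all_to_all_graph n) k E \<longrightarrow> has_depth E d \<longrightarrow>
        \<epsilon> < 1 \<longrightarrow> state_2_design_ensemble n \<epsilon> E \<longrightarrow> real d \<ge> c * ln (real n))"
proof (intro conjI)
  show "\<forall>n G k d \<epsilon> E. odd n \<longrightarrow> architecture n G \<longrightarrow> symplectic_ensemble n G k E \<longrightarrow> has_depth E d \<longrightarrow>
        \<epsilon> < 1 \<longrightarrow> state_2_design_ensemble n \<epsilon> E \<longrightarrow> full_lightcones n E"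
    using design_full_lightcones by blast
next
  show "\<forall>k. \<exists>c > 0. \<exists>N. \<forall>n \<ge> N. \<forall>G \<in> {line_graph n, ring_graph n}. \<forall>d \<epsilon> E.
        odd n \<longrightarrow> symplectic_ensemble n G k E \<longrightarrow> has_depth E d \<longrightarrow>
        \<epsilon> < 1 \<longrightarrow> state_2_design_ensemble n \<epsilon> E \<longrightarrow> real d \<ge> c * real n"
  \<comment> \<open>The factor 4 absorbs the summand 1 of the counting bound; the 1 in the
    denominator keeps it positive for k = 0.\<close>
  proof (rule allI, rule exI[of _ "1 / (4 * (real k * real k + 1))" for k],
      intro conjI exI[of _ 2] allI ballI impI)
    fix k n d :: nat and G \<epsilon> E
    assume n: "2 \<le> n" "odd n" and G: "G \<in> {line_graph n, ring_graph n}"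
      and E: "symplectic_ensemble n G k E" "has_depth E d" "\<epsilon> < 1" "state_2_design_ensemble n \<epsilon> E"
    obtain C where C: "local_symplectic_circuit n G k C" "length C \<le> d" "{..<n} \<subseteq> lightcone C 0"
      using design_exists_full_lightcone[OF n(2) E] .
    have "G \<subseteq> ring_graph n" using G line_graph_subset_ring_graph by auto
    from ring_depth_bound[OF C(1) this C(3)] have "n \<le> 2 * (length C * (k * k)) + 1" .
    also have "\<dots> \<le> 2 * (d * (k * k)) + 1" using C(2) by (simp add: mult_le_mono1)
    \<comment> \<open>With m = d * (k * k), n \<ge> 2 excludes m = 0, and 2 * m + 1 \<le> 4 * m for
      m \<ge> 1.\<close>
    finally have "n \<le> 2 * (2 * (d * (k * k)))" using n(1) by linarith
    also have "\<dots> \<le> 4 * (d * (k * k + 1))" by (simp add: algebra_simps)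
    finally have "real n \<le> real (4 * (d * (k * k + 1)))" by (rule of_nat_mono)
    then have "real n \<le> real d * (4 * (real k * real k + 1))" by (simp add: algebra_simps)
    moreover have "0 < 4 * (real k * real k + 1)" by (simp add: add_nonneg_pos)
    ultimately show "1 / (4 * (real k * real k + 1)) * real n \<le> real d"
      by (simp add: pos_divide_le_eq)
  qed (simp add: add_nonneg_pos)
next
  show "\<forall>k. \<exists>c > 0. \<exists>N. \<forall>n \<ge> N. \<forall>d \<epsilon> E.
        odd n \<longrightarrow> symplectic_ensemble n (all_to_all_graph n) k E \<longrightarrow> has_depth E d \<longrightarrow>
        \<epsilon> < 1 \<longrightarrow> state_2_design_ensemble n \<epsilon> E \<longrightarrow> real d \<ge> c * ln (real n)"
  \<comment> \<open>The constant comes from taking logarithms in n \<le> (k + 2) ^ d.\<close>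
  proof (rule allI, rule exI[of _ "1 / ln (real k + 2)" for k],
      intro conjI exI[of _ 1] allI impI)
    fix k n d :: nat and \<epsilon> E
    assume n: "1 \<le> n" "odd n"
      and E: "symplectic_ensemble n (all_to_all_graph n) k E" "has_depth E d" "\<epsilon> < 1"
        "state_2_design_ensemble n \<epsilon> E"
    obtain C where C: "local_symplectic_circuit n (all_to_all_graph n) k C" "length C \<le> d"
      "{..<n} \<subseteq> lightcone C 0"
      using design_exists_full_lightcone[OF n(2) E] .
    have "n \<le> (k + 2) ^ length C" using all_to_all_depth_bound[OF C(1,3)] .
    also have "\<dots> \<le> (k + 2) ^ d" using C(2) by (intro power_increasing) auto
    finally have "real n \<le> real ((k + 2) ^ d)" by (rule of_nat_mono)
    then have "real n \<le> (real k + 2) ^ d" by (simp add: add.commute)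
    then have "ln (real n) \<le> ln ((real k + 2) ^ d)" using n(1) by (subst ln_le_cancel_iff) auto
    then have "ln (real n) \<le> real d * ln (real k + 2)" by (simp add: ln_realpow)
    then show "1 / ln (real k + 2) * ln (real n) \<le> real d"
      by (simp add: pos_divide_le_eq)
  qed simp
qed

end
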